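(* Let $X_1,X_2,\ldots$ be independent identically distributed random variables with $\mathsf{E}X_1=0$ and $0<\mathsf{E}X_1^2=\sigma^2<\infty$ ($\sigma>0$). For $n\in\mathbb{N}$ and $p\in(0,1]$ let $N_{n,p}$ have the binomial distribution with parameters $n$ and $p$, with $N_{n,p},X_1,X_2,\ldots$ jointly independent, and let $S_{N_{n,p}}=X_1+\ldots+X_{N_{n,p}}$ (equal to $0$ if $N_{n,p}=0$). Then for any $n\in\mathbb{N}$ and $p\in(0,1]$ $$\sup_{z\ge 0}\Big|Q_{S_{N_{n,p}}}(z)-\Phi_0\Big(\frac{z}{2\sigma\sqrt{np}}\Big)\Big|\le\frac{7.4184}{\sigma^2}\,\mathsf{E}X_1^2\min\bigg\{1,\,\frac{|X_1|}{\sigma\sqrt{np}}\bigg\}.$$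
   Context: The concentration function of a random variable $\xi$ is $Q_\xi(z)=\sup_{x\in\mathbb{R}}\mathsf{P}(x\le\xi\le x+z)$, $z\ge 0$. $\Phi$ is the standard normal distribution function, and the folded normal distribution function is $\Phi_0(x)=2\Phi(x)-1$ for $x\ge 0$, $\Phi_0(x)=0$ for $x<0$. *)

theory Defs
  imports "HOL-Probability.Probability"
begin

definition concentration_function :: "'a measure \<Rightarrow> ('a \<Rightarrow> real) \<Rightarrow> real \<Rightarrow> real" where
  "concentration_function M \<xi> z = (SUP x. measure M {\<omega> \<in> space M. x \<le> \<xi> \<omega> \<and> \<xi> \<omega> \<le> x + z})"

definition folded_normal_cdf :: "real \<Rightarrow> real" where
  "folded_normal_cdf x = (if x \<ge> 0 then 2 * cdf std_normal_distribution x - 1 else 0)"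

text \<open>
  The suprema used here are taken in the conditionally complete lattice of the reals. The following
  facts show that they are always over bounded sets, hence genuine.
\<close>

lemma bdd_above_concentration:
  assumes "prob_space M"
  shows "bdd_above (range (\<lambda>x. measure M {\<omega> \<in> space M. x \<le> \<xi> \<omega> \<and> \<xi> \<omega> \<le> x + z}))"
  by (rule bdd_aboveI[of _ 1]) (auto intro: prob_space.prob_le_1[OF assms])

lemma concentration_function_bounds:
  assumes "prob_space M"
  shows "0 \<le> concentration_function M \<xi> z" "concentration_function M \<xi> z \<le> 1"
proof -
  show "concentration_function M \<xi> z \<le> 1"
    unfolding concentration_function_def
    by (rule cSUP_least) (auto intro: prob_space.prob_le_1[OF assms])
  have "0 \<le> measure M {\<omega> \<in> space M. 0 \<le> \<xi> \<omega> \<and> \<xi> \<omega> \<le> 0 + z}" by simp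
  also have "\<dots> \<le> concentration_function M \<xi> z"
    unfolding concentration_function_def
    by (rule cSUP_upper[OF UNIV_I bdd_above_concentration[OF assms]])
  finally show "0 \<le> concentration_function M \<xi> z" .
qed

lemma abs_folded_normal_cdf_le: "\<bar>folded_normal_cdf x\<bar> \<le> 1"
proof -
  interpret real_distribution std_normal_distribution by (rule real_dist_normal_dist)
  show ?thesis
    using cdf_nonneg[of x] cdf_bounded_prob[of x] by (auto simp: folded_normal_cdf_def)
qed

lemma bdd_above_concentration_folded_normal:
  assumes "prob_space M"
  shows "bdd_above ((\<lambda>z. \<bar>concentration_function M \<xi> z - folded_normal_cdf (c z)\<bar>) ` A)"
proof (rule bdd_aboveI2[of _ _ 2])
  fix z
  show "\<bar>concentration_function M \<xi> z - folded_normal_cdf (c z)\<bar> \<le> 2"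
    using concentration_function_bounds[OF assms, of \<xi> z] abs_folded_normal_cdf_le[of "c z"]
    by linarith
qed

end

theory Submission
  imports Defs "HOL-Real_Asymp.Real_Asymp"
begin

text \<open>
  The binomial sum $S_N$ has the law of a sum of $n$ independent copies of $BX_1$ with $B$ Bernoulli($p$),
  so after division by $\sigma\sqrt{np}$ it is a sum $W$ of i.i.d. variables $Y_i$ of variance $1/n$, and
  the right-hand side is $7.4184\,\beta$ with $\beta = \sum_i E Y_i^2 \min(1,|Y_i|)$. It suffices to
  bound $P(a < W \le b) - (\Phi(b) - \Phi(a))$ by $7.4184\,\beta$ for all $a \le b$; only $\beta < 1/7.4184$
  matters, which forces $n \ge 41$.

  This is Stein's method in the form of Chen and Shao, with their concentration inequality for $W - Y_i$. Working
  with intervals rather than half-lines loses nothing: if $f_z$ solves Stein's equation for $(-\infty,z]$ then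
  $w f_z(w)$ is nondecreasing, so increments of $w(f_b(w) - f_a(w))$ obey the bound for one half-line, and
  the indicator of $(a,b]$ changes under a shift by $r$ upwards only on one interval of length $r$. The
  resulting constant is $3 + \sqrt{2\pi}/2 + 3c < 7.4184$ with $c = 1.0125 \ge \sqrt{41/40} \ge \sqrt{n/(n-1)}$.
\<close>

section \<open>The normal distribution function\<close>

text \<open>Only second moments are finite, so every estimate has to survive truncation. Let F be
  the derivative of the Stein solution f for (a,b] and V = W - Y_i. Then E Y_i f(W) = E Y_i (f(V +
  Y_i) - f(V)) involves F(V + t) for t between 0 and Y_i, and it is compared with E Y_i^2 E F(W).
  Averaging over V removes the jumps of F: E F(V + s) and E F(V + t) differ by at most
  \<open>slope\<close> times |s| + |t|, capped at 2, plus an error \<kappa> = 2c\<beta> left by the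
  concentration inequality. Replacing t by an independent copy of Y_i costs \<open>slope\<close>
  times \<beta>, because E min(1,|Y_i|) \<le> \<beta>; integrating the capped bound over t costs
  another 2\<beta>. Per unit of variance the total is (\<open>slope\<close> + 2 + 2c)\<beta> with
  \<open>slope\<close> = 1 + sqrt(2 pi)/2 + c, which is the announced constant. The n
  Bernoulli-thinned copies need not exist on the given space: they are coordinates of a product
  space, and equality of characteristic functions identifies the two laws.\<close>

abbreviation normal_cdf :: "real \<Rightarrow> real" ("\<Phi>") where "\<Phi> \<equiv> cdf std_normal_distribution"

interpretation std_normal: real_distribution std_normal_distribution
  by (rule real_dist_normal_dist)

lemma normal_cdf_diff:
  assumes "a \<le> b" shows "\<Phi> b - \<Phi> a = (LBINT x:{a..b}. std_normal_density x)"
proof -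
  have "measure std_normal_distribution {a<..b} = (LINT x|std_normal_distribution. indicator {a<..b} x)"
    by simp
  also have "\<dots> = (LBINT x. std_normal_density x * indicator {a<..b} x)"
    by (subst integral_real_density) auto
  also have "\<dots> = (LBINT x:{a<..b}. std_normal_density x)"
    unfolding set_lebesgue_integral_def by (simp add: mult.commute)
  also have "\<dots> = (LBINT x:{a..b}. std_normal_density x)"
    unfolding set_lebesgue_integral_def
    by (intro integral_cong_AE) (auto intro!: eventually_mono[OF AE_lborel_singleton[of a]] simp: indicator_def)
  finally show ?thesis using std_normal.cdf_diff_eq[of a b] assms by (cases "a = b") auto
qed

text \<open>On a bounded window around x, \<Phi> is a constant plus the integral of the density from
  the left end, so the fundamental theorem applies without improper integrals.\<close>

lemma normal_cdf_deriv: "(\<Phi> has_real_derivative std_normal_density x) (at x)"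
proof -
  let ?a = "x - 1" and ?b = "x + 1"
  have cont: "continuous_on {?a..?b} std_normal_density"
    unfolding std_normal_density_def by (intro continuous_intros) auto
  have "((\<lambda>u. integral {?a..u} std_normal_density) has_real_derivative std_normal_density x) (at x within {?a..?b})"
    using integral_has_real_derivative[OF cont, of x] by simp
  then have 1: "((\<lambda>u. integral {?a..u} std_normal_density) has_real_derivative std_normal_density x) (at x)"
    by (subst (asm) at_within_Icc_at) auto
  have eq: "\<Phi> u = integral {?a..u} std_normal_density + \<Phi> ?a" if "u \<in> {?a<..<?b}" for u
  proof -
    have "set_integrable lborel {?a..u} std_normal_density"
      by (intro borel_integrable_atLeastAtMost') (auto simp: std_normal_density_def intro!: continuous_intros)
    then show ?thesis
      using normal_cdf_diff[of ?a u] that set_borel_integral_eq_integral(2)[of "{?a..u}" std_normal_density]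
      by auto
  qed
  have 2: "((\<lambda>u. integral {?a..u} std_normal_density + \<Phi> ?a) has_real_derivative std_normal_density x) (at x)"
    using DERIV_add[OF 1 DERIV_const[of "\<Phi> ?a"]] by simp
  show ?thesis
    by (rule has_field_derivative_transform_within_open[OF 2, of "{?a<..<?b}"]) (auto simp: eq)
qed

lemma std_normal_density_deriv:
  "(std_normal_density has_real_derivative (- x * std_normal_density x)) (at x)"
  unfolding std_normal_density_def
  by (rule derivative_eq_intros refl | simp)+

text \<open>By symmetry of the density \<Phi>(x) + \<Phi>(-x) has derivative 0; the constant is read
  off at infinity.\<close>

lemma normal_cdf_uminus: "\<Phi> (- x) = 1 - \<Phi> x"
proof -
  have "((\<lambda>x. \<Phi> x + \<Phi> (- x)) has_real_derivative 0) (at x)" for x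
  proof -
    have "((\<lambda>x. \<Phi> x + \<Phi> (- x)) has_real_derivative
       (std_normal_density x + std_normal_density (- x) * (- 1))) (at x)"
      by (intro DERIV_add normal_cdf_deriv DERIV_chain2[OF normal_cdf_deriv])
         (auto intro!: derivative_eq_intros)
    then show ?thesis by (simp add: std_normal_density_def)
  qed
  then have c: "\<Phi> y + \<Phi> (- y) = \<Phi> x + \<Phi> (- x)" for x y
    by (rule DERIV_isconst_all[rule_format, rotated])
  have "((\<lambda>y. \<Phi> y + \<Phi> (- y)) \<longlongrightarrow> 1 + 0) at_top"
    by (intro tendsto_add std_normal.cdf_lim_at_top_prob
         filterlim_compose[OF std_normal.cdf_lim_at_bot filterlim_uminus_at_bot_at_top])
  then have "((\<lambda>y::real. \<Phi> x + \<Phi> (- x)) \<longlongrightarrow> 1) at_top"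
    by (subst (asm) c[of _ x]) simp
  then have "\<Phi> x + \<Phi> (- x) = 1"
    by (simp add: tendsto_const_iff)
  then show ?thesis by simp
qed

lemma normal_cdf_pos: "0 < \<Phi> x"
  by (rule DERIV_pos_imp_increasing_at_bot[OF _ std_normal.cdf_lim_at_bot])
     (auto intro!: exI normal_cdf_deriv normal_density_pos)

lemma normal_cdf_less_one: "\<Phi> x < 1"
  using normal_cdf_pos[of "- x"] by (simp add: normal_cdf_uminus)

text \<open>Needed only to pass from half-open to closed intervals by a small enlargement, so the
  crude bound 1 on the density is enough.\<close>

lemma normal_cdf_diff_le:
  assumes "a \<le> b" shows "\<Phi> b - \<Phi> a \<le> b - a"
proof -
  have "\<Phi> b - b \<le> \<Phi> a - a"
  proof (rule DERIV_nonpos_imp_nonincreasing[OF assms])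
    fix x
    have "std_normal_density x \<le> 1"
    proof -
      have "1 \<le> sqrt (2 * pi)" using pi_gt3 by (simp add: real_le_rsqrt)
      then show ?thesis unfolding std_normal_density_def
        by (intro mult_le_one) (auto simp: divide_le_eq)
    qed
    moreover have "((\<lambda>x. \<Phi> x - x) has_real_derivative (std_normal_density x - 1)) (at x)"
      by (intro DERIV_diff normal_cdf_deriv DERIV_ident)
    ultimately show "\<exists>y. ((\<lambda>x. \<Phi> x - x) has_real_derivative y) (at x) \<and> y \<le> 0"
      by (intro exI conjI) auto
  qed
  then show ?thesis by simp
qed

text \<open>The difference increases on $(-\infty, -\sqrt{2/\pi}]$ from its limit $0$, then decreases to $0$ at $0$.\<close>
lemma normal_cdf_le_exp:
  assumes "x \<le> 0" shows "\<Phi> x \<le> exp (- x\<^sup>2 / 2) / 2"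
proof -
  define u where "u x = exp (- x\<^sup>2 / 2) / 2 - \<Phi> x" for x
  define c where "c = 2 / sqrt (2 * pi)"
  have c: "c > 0" by (simp add: c_def)
  have d: "(u has_real_derivative (exp (- x\<^sup>2 / 2) * (- x - c) / 2)) (at x)" for x
    unfolding u_def
    by (rule derivative_eq_intros normal_cdf_deriv refl | simp)+
       (simp add: std_normal_density_def c_def field_simps)
  have l: "(u \<longlongrightarrow> 0) at_bot"
  proof -
    have "((\<lambda>x::real. exp (- x\<^sup>2 / 2) / 2) \<longlongrightarrow> 0) at_bot" by real_asymp
    from tendsto_diff[OF this std_normal.cdf_lim_at_bot] show ?thesis by (simp add: u_def[abs_def])
  qed
  have "u x \<ge> 0"
  proof (cases "x < - c")
    case True
    have "u x > 0"
      by (rule DERIV_pos_imp_increasing_at_bot[OF _ l]) (use True in \<open>auto intro!: exI d mult_pos_pos\<close>)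
    then show ?thesis by simp
  next
    case False
    have "u 0 \<le> u x"
      by (rule DERIV_nonpos_imp_nonincreasing[OF assms])
         (use False in \<open>auto intro!: exI d simp: mult_nonneg_nonpos\<close>)
    moreover have "u 0 = 0" using normal_cdf_uminus[of 0] by (simp add: u_def)
    ultimately show ?thesis by simp
  qed
  then show ?thesis by (simp add: u_def)
qed

text \<open>Turns a limit at minus infinity containing \<Phi> into one with an explicit Gaussian
  factor, which dominates \<Phi> on the negative half-line.\<close>

lemma normal_cdf_tendsto_mult:
  assumes "((\<lambda>x. g x * exp (- x\<^sup>2 / 2)) \<longlongrightarrow> 0) at_bot"
  shows "((\<lambda>x. g x * \<Phi> x) \<longlongrightarrow> 0) at_bot"
proof (rule Lim_null_comparison[OF _ tendsto_norm_zero[OF assms]])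
  show "\<forall>\<^sub>F x in at_bot. norm (g x * \<Phi> x) \<le> norm (g x * exp (- x\<^sup>2 / 2))"
    using eventually_le_at_bot[of 0]
  proof eventually_elim
    case (elim x)
    have "\<Phi> x \<le> exp (- x\<^sup>2 / 2)"
      using normal_cdf_le_exp[OF elim] exp_gt_zero[of "- x\<^sup>2 / 2"] by linarith
    then show ?case
      using normal_cdf_pos[of x] by (auto simp: abs_mult intro!: mult_left_mono)
  qed
qed

text \<open>The left tail tends to 0 and the derivative is \<Phi> x > 0. Divided by the density,
  this is the positivity of 1 + w * \<open>mills w\<close>, the derivative of
  \<open>mills\<close>.\<close>

lemma mills_lower: "0 < std_normal_density x + x * \<Phi> x"
proof (rule DERIV_pos_imp_increasing_at_bot[where f = "\<lambda>x. std_normal_density x + x * \<Phi> x" and b = x])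
  show "\<exists>d. ((\<lambda>x. std_normal_density x + x * \<Phi> x) has_real_derivative d) (at x) \<and> 0 < d" for x
    by (rule exI[of _ "\<Phi> x"])
       (auto intro!: derivative_eq_intros std_normal_density_deriv normal_cdf_deriv normal_cdf_pos)
  have "((\<lambda>x::real. x * exp (- x\<^sup>2 / 2)) \<longlongrightarrow> 0) at_bot" by real_asymp
  moreover have "(std_normal_density \<longlongrightarrow> 0) at_bot"
    unfolding std_normal_density_def[abs_def] by real_asymp
  ultimately show "((\<lambda>x. std_normal_density x + x * \<Phi> x) \<longlongrightarrow> 0) at_bot"
    using tendsto_add[OF _ normal_cdf_tendsto_mult[of "\<lambda>x. x"], of std_normal_density 0] by simp
qed

text \<open>The same scheme one order higher: the derivative is twice the quantity of
  \<open>mills_lower\<close>. Divided by the density, the expression is the derivative of w *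
  \<open>mills w\<close>.\<close>

lemma mills_upper: "0 < (1 + x\<^sup>2) * \<Phi> x + x * std_normal_density x"
proof (rule DERIV_pos_imp_increasing_at_bot[where f = "\<lambda>x. (1 + x\<^sup>2) * \<Phi> x + x * std_normal_density x" and b = x])
  show "\<exists>d. ((\<lambda>x. (1 + x\<^sup>2) * \<Phi> x + x * std_normal_density x) has_real_derivative d) (at x) \<and> 0 < d" for x
  proof (intro exI conjI)
    show "((\<lambda>x. (1 + x\<^sup>2) * \<Phi> x + x * std_normal_density x) has_real_derivative
        2 * (std_normal_density x + x * \<Phi> x)) (at x)"
      by (rule derivative_eq_intros std_normal_density_deriv normal_cdf_deriv refl | simp)+
         (simp add: algebra_simps power2_eq_square)
    show "0 < 2 * (std_normal_density x + x * \<Phi> x)" using mills_lower[of x] by simp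
  qed
  have "((\<lambda>x::real. (1 + x\<^sup>2) * exp (- x\<^sup>2 / 2)) \<longlongrightarrow> 0) at_bot" by real_asymp
  moreover have "((\<lambda>x. x * std_normal_density x) \<longlongrightarrow> 0) at_bot"
    unfolding std_normal_density_def[abs_def] by real_asymp
  ultimately show "((\<lambda>x. (1 + x\<^sup>2) * \<Phi> x + x * std_normal_density x) \<longlongrightarrow> 0) at_bot"
    using tendsto_add[OF normal_cdf_tendsto_mult[of "\<lambda>x. 1 + x\<^sup>2"], of "\<lambda>x. x * std_normal_density x" 0]
    by simp
qed

section \<open>Stein's equation for half-lines\<close>

text \<open>The Mills ratio seen from the left tail: \<open>mills (- w)\<close> is the usual
  quotient of 1 - \<Phi> w by the density.\<close>

definition mills :: "real \<Rightarrow> real" where "mills w = \<Phi> w / std_normal_density w"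

text \<open>The bounded solution f of f'(w) - w f(w) = 1(w \<le> z) - \<Phi> z. Both branches solve
  the equation because \<open>mills\<close> satisfies m' = 1 + w m.\<close>

definition stein :: "real \<Rightarrow> real \<Rightarrow> real" where
  "stein z w = (if w \<le> z then (1 - \<Phi> z) * mills w else \<Phi> z * mills (- w))"

text \<open>Read off from the equation instead of from a derivative, so that the equation holds
  everywhere; at w = z, where the solution has a kink, the value is the left derivative.\<close>

definition stein_deriv :: "real \<Rightarrow> real \<Rightarrow> real" where
  "stein_deriv z w = w * stein z w + indicator {..z} w - \<Phi> z"

lemma std_normal_density_pos: "0 < std_normal_density w"
  by (simp add: normal_density_pos)

lemma std_normal_density_uminus: "std_normal_density (- w) = std_normal_density w"
  by (simp add: std_normal_density_def)

lemma mills_pos: "0 < mills w"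
  by (simp add: mills_def normal_cdf_pos std_normal_density_pos)

lemma mills_deriv: "(mills has_real_derivative (1 + w * mills w)) (at w)"
  unfolding mills_def[abs_def]
  by (rule derivative_eq_intros std_normal_density_deriv normal_cdf_deriv refl | simp)+
     (use std_normal_density_pos[of w] in \<open>simp_all add: field_simps power2_eq_square\<close>)

lemma one_plus_mult_mills_pos: "0 < 1 + w * mills w"
  using mills_lower[of w] std_normal_density_pos[of w]
  by (simp add: mills_def field_simps)

lemma strict_mono_mult_mills: "strict_mono (\<lambda>w. w * mills w)"
proof (rule strict_monoI)
  fix v w :: real assume "v < w"
  then show "v * mills v < w * mills w"
  proof (rule DERIV_pos_imp_increasing)
    fix x
    have "0 < mills x + x * (1 + x * mills x)"
      using mills_upper[of x] std_normal_density_pos[of x]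
      by (simp add: mills_def field_simps power2_eq_square)
    moreover have "((\<lambda>w. w * mills w) has_real_derivative (mills x + x * (1 + x * mills x))) (at x)"
      by (auto intro!: derivative_eq_intros mills_deriv)
    ultimately show "\<exists>y. ((\<lambda>w. w * mills w) has_real_derivative y) (at x) \<and> 0 < y" by blast
  qed
qed

lemma mills_le:
  assumes "w \<le> 0" shows "mills w \<le> sqrt (2 * pi) / 2"
  using normal_cdf_le_exp[OF assms]
  by (simp add: mills_def std_normal_density_def field_simps)

text \<open>Both sides are \<Phi> z (1 - \<Phi> z) divided by the density at z. Hence the branches
  of \<open>stein\<close> agree at z, and arguments can be moved from z to -z.\<close>

lemma mills_times_cdf: "(1 - \<Phi> z) * mills z = \<Phi> z * mills (- z)"
  by (simp add: mills_def normal_cdf_uminus std_normal_density_uminus)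

text \<open>Reflection reduces statements about $w \ge z$ to $w \le z$.\<close>
lemma stein_uminus: "stein (- z) (- w) = stein z w"
  using mills_times_cdf[of z] by (auto simp: stein_def normal_cdf_uminus)

lemma stein_nonneg: "0 \<le> stein z w"
  using normal_cdf_pos[of z] normal_cdf_less_one[of z] mills_pos[of w] mills_pos[of "- w"]
  by (simp add: stein_def)

lemma stein_le: "stein z w \<le> sqrt (2 * pi) / 2"
proof -
  have *: "stein z w \<le> sqrt (2 * pi) / 2" if "w \<le> z" for z w
  proof (cases "w \<le> 0")
    case True
    have "stein z w \<le> 1 * mills w"
      using that normal_cdf_pos[of z] mills_pos[of w] unfolding stein_def
      by (auto intro!: mult_right_mono)
    then show ?thesis using mills_le[OF True] by simp
  next
    case False
    \<comment> \<open>For 0 < w \<le> z the weight grows when z is lowered to w; the matching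
      identity then moves the argument to -w, where the bound on \<open>mills\<close>
      applies.\<close>
    have "stein z w \<le> (1 - \<Phi> w) * mills w"
      using that mills_pos[of w] std_normal.cdf_nondecreasing[OF that]
      by (auto simp: stein_def intro!: mult_right_mono)
    also have "\<dots> = \<Phi> w * mills (- w)" by (rule mills_times_cdf)
    also have "\<dots> \<le> 1 * mills (- w)"
      using mills_pos[of "- w"] normal_cdf_less_one[of w] by (intro mult_right_mono) auto
    finally show ?thesis using mills_le[of "- w"] False by simp
  qed
  show ?thesis using *[of w z] *[of "- w" "- z"] by (cases "w \<le> z") (auto simp: stein_uminus)
qed

text \<open>The lower bound is 1 + w * \<open>mills w\<close> > 0. For the upper bound, monotonicity
  moves w up to z, and after changing the branch there the same inequality at -z applies. The range
  has length 1, which later caps the increments of w * \<open>stein z w\<close>.\<close>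

lemma mult_stein_bounds: "\<Phi> z - 1 \<le> w * stein z w \<and> w * stein z w \<le> \<Phi> z"
proof -
  have *: "\<Phi> z - 1 \<le> w * stein z w \<and> w * stein z w \<le> \<Phi> z" if "w \<le> z" for z w
  proof
    have "(1 - \<Phi> z) * (- 1) \<le> (1 - \<Phi> z) * (w * mills w)"
      using one_plus_mult_mills_pos[of w] normal_cdf_less_one[of z] by (intro mult_left_mono) auto
    then show "\<Phi> z - 1 \<le> w * stein z w" using that by (simp add: stein_def algebra_simps)
    have "w * stein z w = (1 - \<Phi> z) * (w * mills w)" using that by (simp add: stein_def)
    also have "\<dots> \<le> (1 - \<Phi> z) * (z * mills z)"
      using that normal_cdf_less_one[of z] strict_mono_mono[OF strict_mono_mult_mills]
      by (intro mult_left_mono) (auto dest: monoD)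
    also have "\<dots> = \<Phi> z * (z * mills (- z))" using mills_times_cdf[of z] by (simp add: ac_simps)
    also have "\<dots> \<le> \<Phi> z * 1"
      using one_plus_mult_mills_pos[of "- z"] normal_cdf_pos[of z] by (intro mult_left_mono) auto
    finally show "w * stein z w \<le> \<Phi> z" by simp
  qed
  show ?thesis
    using *[of w z] *[of "- w" "- z"] by (cases "w \<le> z") (auto simp: stein_uminus normal_cdf_uminus)
qed

text \<open>On each side of z this is a positive multiple of the increasing function w *
  \<open>mills w\<close> or of its reflection, and the sides match at z. For two levels a and b the
  increments are therefore both nonnegative, so their difference is no larger than a single
  one.\<close>

lemma mono_mult_stein: "mono (\<lambda>w. w * stein z w)"
proof -
  have *: "v * stein z v \<le> w * stein z w" if "v \<le> w" "w \<le> z" for v w z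
  proof -
    have "(1 - \<Phi> z) * (v * mills v) \<le> (1 - \<Phi> z) * (w * mills w)"
      using that normal_cdf_less_one[of z] strict_mono_mono[OF strict_mono_mult_mills]
      by (intro mult_left_mono) (auto dest: monoD)
    then show ?thesis using that by (simp add: stein_def ac_simps)
  qed
  have **: "v * stein z v \<le> w * stein z w" if "v \<le> w" "z \<le> v" for v w
    using *[of "- w" "- v" "- z"] that by (simp add: stein_uminus)
  show ?thesis
  proof (rule monoI)
    fix v w :: real assume "v \<le> w"
    then show "v * stein z v \<le> w * stein z w"
      using *[of v w z] **[of v w] *[of v z z] **[of z w]
      by (cases "w \<le> z"; cases "z \<le> v") auto
  qed
qed

text \<open>The bounds on w * \<open>stein z w\<close> place the derivative in [0, 1] for w \<le> z
  and in [-1, 0] for w > z.\<close>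

lemma abs_stein_deriv_le: "\<bar>stein_deriv z w\<bar> \<le> 1"
proof (cases "w \<le> z")
  case True
  then have "stein_deriv z w = w * stein z w + 1 - \<Phi> z" by (simp add: stein_deriv_def)
  then show ?thesis
    using mult_stein_bounds[of z w] by (simp add: abs_le_iff)
next
  case False
  then have "stein_deriv z w = w * stein z w - \<Phi> z" by (simp add: stein_deriv_def)
  then show ?thesis
    using mult_stein_bounds[of z w] by (simp add: abs_le_iff)
qed

lemma stein_has_deriv:
  assumes "w \<noteq> z" shows "(stein z has_real_derivative stein_deriv z w) (at w)"
proof (cases "w < z")
  case True
  have "((\<lambda>w. (1 - \<Phi> z) * mills w) has_real_derivative stein_deriv z w) (at w)"
    using True by (auto intro!: derivative_eq_intros mills_deriv
      simp: stein_deriv_def stein_def algebra_simps)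
  then show ?thesis
    by (rule has_field_derivative_transform_within_open[of _ _ _ "{..<z}"])
       (use True in \<open>auto simp: stein_def\<close>)
next
  case False
  have "((\<lambda>w. \<Phi> z * mills (- w)) has_real_derivative
      \<Phi> z * ((1 + (- w) * mills (- w)) * (- 1))) (at w)"
    by (intro DERIV_cmult DERIV_chain2[OF mills_deriv]) (auto intro!: derivative_eq_intros)
  then have "((\<lambda>w. \<Phi> z * mills (- w)) has_real_derivative stein_deriv z w) (at w)"
    using False assms by (simp add: stein_deriv_def stein_def algebra_simps)
  then show ?thesis
    by (rule has_field_derivative_transform_within_open[of _ _ _ "{z<..}"])
       (use False assms in \<open>auto simp: stein_def\<close>)
qed

lemma isCont_mills: "isCont mills w"
  using mills_deriv DERIV_isCont by blast

lemma continuous_on_stein: "continuous_on UNIV (stein z)"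
proof -
  have m: "continuous_on A mills" for A
    using isCont_mills continuous_at_imp_continuous_on by blast
  have m': "continuous_on A (\<lambda>w. mills (- w))" for A
    by (rule continuous_on_compose2[OF m[of UNIV]]) (auto intro!: continuous_intros)
  have "continuous_on ({..z} \<union> {z..}) (\<lambda>w. if w \<le> z then (1 - \<Phi> z) * mills w else \<Phi> z * mills (- w))"
    by (rule continuous_on_cases)
       (auto intro!: continuous_intros m m' simp: mills_times_cdf)
  moreover have "{..z} \<union> {z..} = (UNIV :: real set)" by auto
  ultimately show ?thesis by (simp add: stein_def[abs_def])
qed

lemma borel_measurable_stein [measurable]: "stein z \<in> borel_measurable borel"
  by (rule borel_measurable_continuous_onI[OF continuous_on_stein])

lemma borel_measurable_stein_deriv [measurable]: "stein_deriv z \<in> borel_measurable borel"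
  unfolding stein_deriv_def[abs_def] by measurable

lemma set_integrable_stein_deriv: "set_integrable lborel {p..q} (stein_deriv z)"
  unfolding set_integrable_def
proof (rule Bochner_Integration.integrable_bound)
  show "integrable lborel (\<lambda>t. indicator {p..q} t :: real)"
    by (simp add: integrable_indicator_iff emeasure_lborel_Icc_eq)
qed (auto simp: indicator_def abs_stein_deriv_le)

text \<open>The kink at z is a single exceptional point, harmless to the fundamental theorem because
  \<open>stein z\<close> is continuous there.\<close>

lemma stein_diff_eq_integral:
  assumes "p \<le> q"
  shows "stein z q - stein z p = (LBINT t:{p..q}. stein_deriv z t)"
proof -
  have 1: "(stein_deriv z has_integral stein z q - stein z p) {p..q}"
    by (rule fundamental_theorem_of_calculus_interior_strong[of "{z}"])
       (use assms in \<open>auto simp flip: has_real_derivative_iff_has_vector_derivative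
          intro!: stein_has_deriv continuous_on_subset[OF continuous_on_stein]\<close>)
  from set_borel_integral_eq_integral(2)[OF set_integrable_stein_deriv, of p q z] 1 show ?thesis by (simp add: integral_unique)
qed

lemma stein_lipschitz: "\<bar>stein z q - stein z p\<bar> \<le> \<bar>q - p\<bar>"
proof -
  have *: "\<bar>stein z q - stein z p\<bar> \<le> q - p" if "p \<le> q" for p q
  proof -
    have "norm (LBINT t:{p..q}. stein_deriv z t) \<le> (LBINT t. indicator {p..q} t)"
      unfolding set_lebesgue_integral_def
    proof (rule Bochner_Integration.integral_norm_bound_integral)
      show "integrable lborel (\<lambda>t. indicator {p..q} t *\<^sub>R stein_deriv z t)"
        using set_integrable_stein_deriv[of p q z] by (simp add: set_integrable_def)
      show "integrable lborel (\<lambda>t. indicator {p..q} t :: real)"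
        by (simp add: integrable_indicator_iff emeasure_lborel_Icc_eq)
    qed (auto simp: indicator_def abs_stein_deriv_le)
    then show ?thesis using that by (simp add: stein_diff_eq_integral)
  qed
  show ?thesis using *[of p q] *[of q p] by (cases "p \<le> q") auto
qed

text \<open>The increment equals v (f(v+t) - f(v+s)) + t f(v+t) - s f(v+s). The Lipschitz constant 1
  controls the first part and the supremum of f the other two. The cap 1 is the length of the range
  of w f(w).\<close>

lemma mult_stein_diff_le:
  assumes "s \<le> t"
  shows "(v + t) * stein z (v + t) - (v + s) * stein z (v + s)
    \<le> min 1 ((\<bar>v\<bar> + sqrt (2 * pi) / 2) * (\<bar>s\<bar> + \<bar>t\<bar>))"
proof -
  have "v * (stein z (v + t) - stein z (v + s)) \<le> \<bar>v\<bar> * \<bar>t - s\<bar>"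
    using stein_lipschitz[of z "v + t" "v + s"]
    by (intro order.trans[OF abs_ge_self[of "v * _"]]) (auto simp: abs_mult intro!: mult_left_mono)
  also have "\<dots> \<le> \<bar>v\<bar> * (\<bar>s\<bar> + \<bar>t\<bar>)" by (intro mult_left_mono) auto
  finally have 1: "v * (stein z (v + t) - stein z (v + s)) \<le> \<bar>v\<bar> * (\<bar>s\<bar> + \<bar>t\<bar>)" .
  have "t * stein z (v + t) \<le> \<bar>t\<bar> * (sqrt (2 * pi) / 2)" "- s * stein z (v + s) \<le> \<bar>s\<bar> * (sqrt (2 * pi) / 2)"
    using stein_nonneg stein_le by (intro mult_mono; auto)+
  with 1 have "(v + t) * stein z (v + t) - (v + s) * stein z (v + s)
      \<le> \<bar>v\<bar> * (\<bar>s\<bar> + \<bar>t\<bar>) + \<bar>t\<bar> * (sqrt (2 * pi) / 2) + \<bar>s\<bar> * (sqrt (2 * pi) / 2)"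
    by (simp add: algebra_simps)
  also have "\<dots> = (\<bar>v\<bar> + sqrt (2 * pi) / 2) * (\<bar>s\<bar> + \<bar>t\<bar>)" by (simp add: algebra_simps)
  finally show ?thesis
    using mult_stein_bounds[of z "v + t"] mult_stein_bounds[of z "v + s"] by linarith
qed

section \<open>Concentration of sums of independent variables\<close>

context prob_space begin

lemma expectation_square_sum:
  fixes Z :: "'i \<Rightarrow> 'a \<Rightarrow> real"
  assumes "finite J" "indep_vars (\<lambda>_. borel) Z J"
    and "\<And>j. j \<in> J \<Longrightarrow> integrable M (Z j)" "\<And>j. j \<in> J \<Longrightarrow> expectation (Z j) = 0"
    and "\<And>j. j \<in> J \<Longrightarrow> integrable M (\<lambda>\<omega>. (Z j \<omega>)\<^sup>2)"
  shows "integrable M (\<lambda>\<omega>. (\<Sum>j\<in>J. Z j \<omega>)\<^sup>2) \<and>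
    expectation (\<lambda>\<omega>. (\<Sum>j\<in>J. Z j \<omega>)\<^sup>2) = (\<Sum>j\<in>J. expectation (\<lambda>\<omega>. (Z j \<omega>)\<^sup>2))"
  using assms
proof (induction J rule: finite_induct)
  case (insert i J)
  let ?S = "\<lambda>\<omega>. \<Sum>j\<in>J. Z j \<omega>"
  have IH: "integrable M (\<lambda>\<omega>. (?S \<omega>)\<^sup>2)"
    "expectation (\<lambda>\<omega>. (?S \<omega>)\<^sup>2) = (\<Sum>j\<in>J. expectation (\<lambda>\<omega>. (Z j \<omega>)\<^sup>2))"
    using insert indep_vars_subset[OF insert.prems(1), of J] by auto
  have ind: "indep_var borel (Z i) borel ?S"
    using insert by (intro indep_vars_sum) auto
  have int: "integrable M (Z i)" "integrable M ?S" "integrable M (\<lambda>\<omega>. (Z i \<omega>)\<^sup>2)"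
    using insert.prems by auto
  have cross: "integrable M (\<lambda>\<omega>. Z i \<omega> * ?S \<omega>)" "expectation (\<lambda>\<omega>. Z i \<omega> * ?S \<omega>) = 0"
    using indep_var_integrable[OF ind] indep_var_lebesgue_integral[OF ind] int insert.prems(3) by auto
  have eq: "(\<Sum>j\<in>insert i J. Z j \<omega>)\<^sup>2 = (Z i \<omega>)\<^sup>2 + 2 * (Z i \<omega> * ?S \<omega>) + (?S \<omega>)\<^sup>2" for \<omega>
    using insert.hyps by (simp add: power2_sum)
  show ?case unfolding eq
    using int cross IH insert.hyps by auto
qed (auto)

text \<open>This is nonnegativity of the variance of |Z|.\<close>

lemma expectation_abs_le_sqrt:
  fixes Z :: "'a \<Rightarrow> real"
  assumes "integrable M Z" "integrable M (\<lambda>\<omega>. (Z \<omega>)\<^sup>2)"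
  shows "expectation (\<lambda>\<omega>. \<bar>Z \<omega>\<bar>) \<le> sqrt (expectation (\<lambda>\<omega>. (Z \<omega>)\<^sup>2))"
  using variance_eq[of "\<lambda>\<omega>. \<bar>Z \<omega>\<bar>"] variance_positive[of "\<lambda>\<omega>. \<bar>Z \<omega>\<bar>"] assms
  by (intro real_le_rsqrt) auto

lemma integrable_of_square:
  fixes Z :: "'a \<Rightarrow> real"
  assumes [measurable]: "random_variable borel Z" and "integrable M (\<lambda>\<omega>. (Z \<omega>)\<^sup>2)"
  shows "integrable M Z"
proof (rule Bochner_Integration.integrable_bound)
  show "integrable M (\<lambda>\<omega>. 1 + (Z \<omega>)\<^sup>2)" using assms by simp
  have "\<bar>x\<bar> \<le> 1 + x\<^sup>2" for x :: real
    using sum_squares_bound[of "\<bar>x\<bar>" 1] by (auto simp: power2_eq_square)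
  then show "AE \<omega> in M. norm (Z \<omega>) \<le> norm (1 + (Z \<omega>)\<^sup>2)"
    by (auto intro: order.trans)
qed simp

text \<open>The function r - r^2 / (2\<beta>) has its maximum \<beta>/2 at r = \<beta>, which is
  where the truncation level \<beta>/2 comes from. For r > 1 the left side is nonpositive because
  2\<beta> \<le> 1.\<close>

lemma square_minus_le_truncated:
  fixes y :: real
  assumes "0 < \<beta>" "\<beta> \<le> 1/2"
  shows "y\<^sup>2 - y\<^sup>2 * min 1 \<bar>y\<bar> / (2 * \<beta>) \<le> \<bar>y\<bar> * min (\<beta> / 2) \<bar>y\<bar>"
proof -
  define r where "r = \<bar>y\<bar>"
  have r: "r \<ge> 0" "y\<^sup>2 = r * r" by (auto simp: r_def power2_eq_square)
  have "r * r - r * r * min 1 r / (2 * \<beta>) \<le> r * min (\<beta> / 2) r"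
  proof -
    consider "r < \<beta> / 2" | "\<beta> / 2 \<le> r" "r \<le> 1" | "1 < r" by linarith
    then show ?thesis
    proof cases
      case 1
      then show ?thesis using r assms by auto
    next
      case 2
      have "0 \<le> r * (r - \<beta>)\<^sup>2" using r by simp
      then have "2 * \<beta> * (r * r) - r * r * r \<le> 2 * \<beta> * (r * (\<beta> / 2))"
        by (simp add: power2_eq_square algebra_simps)
      then have "r * r - r * r * r / (2 * \<beta>) \<le> r * (\<beta> / 2)"
        using assms by (simp add: field_simps)
      then show ?thesis using 2 by auto
    next
      case 3
      have "r * r * (2 * \<beta>) \<le> r * r * 1" using r assms by (intro mult_left_mono) auto
      then have "r * r - r * r / (2 * \<beta>) \<le> 0" using assms by (simp add: field_simps)
      moreover have "0 \<le> r * min (\<beta> / 2) r" using r assms by auto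
      ultimately show ?thesis using 3 by auto
    qed
  qed
  then show ?thesis unfolding r_def[symmetric] r(2) .
qed

text \<open>The clamp function is nondecreasing and has slope one within distance $\delta$ of $[a,b]$.\<close>
lemma clamp_increment:
  fixes y v a b \<delta> :: real
  assumes "a \<le> b" "0 < \<delta>"
  defines "K \<equiv> (b - a) / 2 + \<delta>" and "c \<equiv> (a + b) / 2"
  shows "indicator {a..b} v * (\<bar>y\<bar> * min \<delta> \<bar>y\<bar>)
    \<le> y * (max (- K) (min K (v - c)) - max (- K) (min K (v - y - c)))"
proof -
  let ?d = "max (- K) (min K (v - c)) - max (- K) (min K (v - y - c))"
  show ?thesis
  proof (cases "y \<ge> 0")
    case True
    have "0 \<le> ?d" using True by auto
    moreover have "min \<delta> y \<le> ?d" if "v \<in> {a..b}"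
      using that True assms unfolding K_def c_def by (auto simp: min_def max_def field_simps)
    ultimately show ?thesis using True by (auto simp: indicator_def intro: mult_left_mono)
  next
    case False
    have "?d \<le> 0" using False by auto
    moreover have "?d \<le> - min \<delta> (- y)" if "v \<in> {a..b}"
      using that False assms unfolding K_def c_def by (auto simp: min_def max_def field_simps)
    then have "y * (- min \<delta> (- y)) \<le> y * ?d" if "v \<in> {a..b}"
      using that False by (intro mult_left_mono_neg) auto
    ultimately show ?thesis using False by (auto simp: indicator_def mult_nonpos_nonpos)
  qed
qed

text \<open>The clamp h of height K makes E V h(V) at most K * \<open>sqrt s2\<close>, while
  independence bounds it below by E(\<eta>; A). As \<eta> has mean at least s2/2 and mean deviation
  at most \<delta> * \<open>sqrt s2\<close>, it follows that P(A) s2/2 \<le> (K + \<delta>) *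
  \<open>sqrt s2\<close>, where 2(K + \<delta>) = b - a + 2\<beta>. The truncated moments are
  measured relative to s2 because this sum need not have variance 1.\<close>

lemma prob_sum_in_interval_le:
  fixes Y :: "'i \<Rightarrow> 'a \<Rightarrow> real"
  assumes fin: "finite J" and ind: "indep_vars (\<lambda>_. borel) Y J"
    and sq: "\<And>j. j \<in> J \<Longrightarrow> integrable M (\<lambda>\<omega>. (Y j \<omega>)\<^sup>2)"
    and zero: "\<And>j. j \<in> J \<Longrightarrow> expectation (Y j) = 0"
    and s2: "s2 = (\<Sum>j\<in>J. expectation (\<lambda>\<omega>. (Y j \<omega>)\<^sup>2))" "0 < s2"
    and \<beta>: "(\<Sum>j\<in>J. expectation (\<lambda>\<omega>. (Y j \<omega>)\<^sup>2 * min 1 \<bar>Y j \<omega>\<bar>)) \<le> \<beta> * s2" "0 < \<beta>" "\<beta> \<le> 1/2"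
    and ab: "a \<le> b"
  shows "prob {\<omega> \<in> space M. a \<le> (\<Sum>j\<in>J. Y j \<omega>) \<and> (\<Sum>j\<in>J. Y j \<omega>) \<le> b}
    \<le> (b - a + 2 * \<beta>) / sqrt s2"
proof -
  define V where "V \<omega> = (\<Sum>j\<in>J. Y j \<omega>)" for \<omega>
  define \<delta> where "\<delta> = \<beta> / 2"
  define K where "K = (b - a) / 2 + \<delta>"
  define h where "h w = max (- K) (min K (w - (a + b) / 2))" for w
  define \<zeta> where "\<zeta> y = \<bar>y\<bar> * min \<delta> \<bar>y\<bar>" for y :: real
  define \<eta> where "\<eta> \<omega> = (\<Sum>j\<in>J. \<zeta> (Y j \<omega>))" for \<omega>
  define A where "A = {\<omega> \<in> space M. a \<le> V \<omega> \<and> V \<omega> \<le> b}"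
  have [measurable]: "\<And>j. j \<in> J \<Longrightarrow> random_variable borel (Y j)"
    using ind by (auto simp: indep_vars_def)
  have [measurable]: "random_variable borel V" unfolding V_def by measurable
  have [measurable]: "h \<in> borel_measurable borel" unfolding h_def by measurable
  have [measurable]: "\<zeta> \<in> borel_measurable borel" unfolding \<zeta>_def by measurable
  have [measurable]: "A \<in> events" unfolding A_def by measurable
  have \<delta>: "0 < \<delta>" and K: "0 < K" using \<beta> ab by (auto simp: \<delta>_def K_def intro!: add_nonneg_pos)
  have h_bound: "\<bar>h w\<bar> \<le> K" for w using K by (auto simp: h_def)
  have int: "integrable M (Y j)" if "j \<in> J" for j
    using integrable_of_square[OF _ sq] that by auto
  have V: "integrable M V" "integrable M (\<lambda>\<omega>. (V \<omega>)\<^sup>2)" "expectation (\<lambda>\<omega>. (V \<omega>)\<^sup>2) = s2"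
    using expectation_square_sum[OF fin ind int zero sq] int unfolding V_def s2 by auto
  have \<zeta>_nonneg: "0 \<le> \<zeta> y" for y using \<delta> by (simp add: \<zeta>_def)
  have \<zeta>_le: "\<zeta> y \<le> \<delta> * \<bar>y\<bar>" for y using mult_left_mono[OF min.cobounded1[of \<delta> "\<bar>y\<bar>"], of "\<bar>y\<bar>"] by (simp add: \<zeta>_def mult.commute)
  have \<zeta>_sq: "(\<zeta> y)\<^sup>2 \<le> \<delta>\<^sup>2 * y\<^sup>2" for y
    using power_mono[OF \<zeta>_le \<zeta>_nonneg, of y 2] by (simp add: power_mult_distrib)
  have int_\<zeta>: "integrable M (\<lambda>\<omega>. \<zeta> (Y j \<omega>))" if "j \<in> J" for j
    by (rule Bochner_Integration.integrable_bound[of _ "\<lambda>\<omega>. \<delta> * \<bar>Y j \<omega>\<bar>"])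
       (use that int \<zeta>_le \<zeta>_nonneg \<delta> in auto)
  have int_\<zeta>2: "integrable M (\<lambda>\<omega>. (\<zeta> (Y j \<omega>))\<^sup>2)" if "j \<in> J" for j
    by (rule Bochner_Integration.integrable_bound[of _ "\<lambda>\<omega>. \<delta>\<^sup>2 * (Y j \<omega>)\<^sup>2"])
       (use that sq \<zeta>_sq in auto)
  have int_min: "integrable M (\<lambda>\<omega>. (Y j \<omega>)\<^sup>2 * min 1 \<bar>Y j \<omega>\<bar>)" if "j \<in> J" for j
    by (rule Bochner_Integration.integrable_bound[OF sq[OF that]])
       (use that in \<open>auto simp: abs_mult intro!: mult_left_le\<close>)
  have mean_\<eta>: "s2 / 2 \<le> expectation \<eta>"
  proof -
    have "s2 / 2 \<le> s2 - (\<Sum>j\<in>J. expectation (\<lambda>\<omega>. (Y j \<omega>)\<^sup>2 * min 1 \<bar>Y j \<omega>\<bar>)) / (2 * \<beta>)"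
      using \<beta> by (simp add: field_simps)
    also have "\<dots> = (\<Sum>j\<in>J. expectation (\<lambda>\<omega>. (Y j \<omega>)\<^sup>2 - (Y j \<omega>)\<^sup>2 * min 1 \<bar>Y j \<omega>\<bar> / (2 * \<beta>)))"
      by (simp add: s2(1) sum_subtractf sum_divide_distrib Bochner_Integration.integral_diff sq int_min)
    also have "\<dots> \<le> (\<Sum>j\<in>J. expectation (\<lambda>\<omega>. \<zeta> (Y j \<omega>)))"
    proof (intro sum_mono integral_mono)
      fix j \<omega> assume "j \<in> J"
      show "(Y j \<omega>)\<^sup>2 - (Y j \<omega>)\<^sup>2 * min 1 \<bar>Y j \<omega>\<bar> / (2 * \<beta>) \<le> \<zeta> (Y j \<omega>)"
        unfolding \<zeta>_def \<delta>_def by (rule square_minus_le_truncated[OF \<beta>(2,3)])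
    qed (auto simp: sq int_min int_\<zeta>)
    also have "\<dots> = expectation \<eta>"
      unfolding \<eta>_def by (rule Bochner_Integration.integral_sum[symmetric]) (rule int_\<zeta>)
    finally show ?thesis .
  qed
  \<comment> \<open>\<eta> is a sum of independent terms, each of variance at most \<delta>^2 E
    Y_j^2, since \<zeta>(y) \<le> \<delta> |y|; its standard deviation is thus at most \<delta> *
    \<open>sqrt s2\<close>.\<close>
  have dev_\<eta>: "expectation (\<lambda>\<omega>. \<bar>\<eta> \<omega> - expectation \<eta>\<bar>) \<le> \<delta> * sqrt s2"
    and int_\<eta>: "integrable M \<eta>"
  proof -
    define Z where "Z j \<omega> = \<zeta> (Y j \<omega>) - expectation (\<lambda>\<omega>. \<zeta> (Y j \<omega>))" for j \<omega>
    have indZ: "indep_vars (\<lambda>_. borel) Z J"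
      unfolding Z_def by (rule indep_vars_compose2[OF ind]) measurable
    show "integrable M \<eta>" unfolding \<eta>_def using int_\<zeta> by auto
    have Z1: "integrable M (Z j)" "expectation (Z j) = 0" if "j \<in> J" for j
      using int_\<zeta>[OF that] by (auto simp: Z_def[abs_def] prob_space)
    have Z2: "integrable M (\<lambda>\<omega>. (Z j \<omega>)\<^sup>2)" if "j \<in> J" for j
      using int_\<zeta>[OF that] int_\<zeta>2[OF that] by (auto simp: Z_def[abs_def] power2_diff)
    have Z3: "expectation (\<lambda>\<omega>. (Z j \<omega>)\<^sup>2) \<le> \<delta>\<^sup>2 * expectation (\<lambda>\<omega>. (Y j \<omega>)\<^sup>2)" if "j \<in> J" for j
    proof -
      have "expectation (\<lambda>\<omega>. (Z j \<omega>)\<^sup>2) \<le> expectation (\<lambda>\<omega>. (\<zeta> (Y j \<omega>))\<^sup>2)"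
        unfolding Z_def using variance_eq[OF int_\<zeta>[OF that] int_\<zeta>2[OF that]] by simp
      also have "\<dots> \<le> expectation (\<lambda>\<omega>. \<delta>\<^sup>2 * (Y j \<omega>)\<^sup>2)"
        by (intro integral_mono int_\<zeta>2 that \<zeta>_sq) (use sq that in auto)
      finally show ?thesis by simp
    qed
    note Zsum = expectation_square_sum[OF fin indZ Z1 Z2]
    have eq: "\<eta> \<omega> - expectation \<eta> = (\<Sum>j\<in>J. Z j \<omega>)" for \<omega>
      unfolding \<eta>_def Z_def using int_\<zeta> by (simp add: sum_subtractf)
    have "expectation (\<lambda>\<omega>. \<bar>\<eta> \<omega> - expectation \<eta>\<bar>) \<le> sqrt (expectation (\<lambda>\<omega>. (\<Sum>j\<in>J. Z j \<omega>)\<^sup>2))"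
      unfolding eq by (rule expectation_abs_le_sqrt) (use Zsum Z1 in auto)
    also have "\<dots> \<le> sqrt (\<delta>\<^sup>2 * s2)"
      using Zsum sum_mono[OF Z3] by (simp add: s2(1) sum_distrib_left)
    also have "\<dots> = \<delta> * sqrt s2" using \<delta> by (simp add: real_sqrt_mult)
    finally show "expectation (\<lambda>\<omega>. \<bar>\<eta> \<omega> - expectation \<eta>\<bar>) \<le> \<delta> * sqrt s2" .
  qed
  have upper: "expectation (\<lambda>\<omega>. indicator A \<omega> * \<eta> \<omega>) \<le> K * sqrt s2"
  proof -
    have int_Yh: "integrable M (\<lambda>\<omega>. Y j \<omega> * h (U \<omega>))"
      if "j \<in> J" and [measurable]: "random_variable borel U" for j U
    proof (rule Bochner_Integration.integrable_bound[of _ "\<lambda>\<omega>. K * \<bar>Y j \<omega>\<bar>"])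
      show "AE \<omega> in M. norm (Y j \<omega> * h (U \<omega>)) \<le> norm (K * \<bar>Y j \<omega>\<bar>)"
        using h_bound K by (auto simp: abs_mult mult.commute[of K] intro!: mult_left_mono)
    qed (use that int in auto)
    \<comment> \<open>Y_j is centred and independent of V - Y_j. Subtracting this null term turns
      Y_j h(V) into Y_j times an increment of h, which \<open>clamp_increment\<close> bounds
      below.\<close>
    have zero_term: "expectation (\<lambda>\<omega>. Y j \<omega> * h (V \<omega> - Y j \<omega>)) = 0" if j: "j \<in> J" for j
    proof -
      have eq: "V \<omega> - Y j \<omega> = (\<Sum>i\<in>J - {j}. Y i \<omega>)" for \<omega>
        using fin j by (simp add: V_def sum_diff1)
      have "indep_var borel (Y j) borel (\<lambda>\<omega>. V \<omega> - Y j \<omega>)"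
        unfolding eq using fin j ind by (intro indep_vars_sum) (auto simp: insert_absorb)
      then have "indep_var borel (Y j) borel (\<lambda>\<omega>. h (V \<omega> - Y j \<omega>))"
        using indep_var_compose[of borel "Y j" borel "\<lambda>\<omega>. V \<omega> - Y j \<omega>" "\<lambda>x. x" borel h borel]
        by (simp add: comp_def)
      moreover have "integrable M (\<lambda>\<omega>. h (V \<omega> - Y j \<omega>))"
        by (rule integrable_const_bound[of _ K]) (use h_bound j in auto)
      ultimately have "expectation (\<lambda>\<omega>. Y j \<omega> * h (V \<omega> - Y j \<omega>))
          = expectation (Y j) * expectation (\<lambda>\<omega>. h (V \<omega> - Y j \<omega>))"
        by (intro indep_var_lebesgue_integral int j)
      then show ?thesis using zero[OF j] by simp
    qed
    have "expectation (\<lambda>\<omega>. indicator A \<omega> * \<eta> \<omega>)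
        \<le> expectation (\<lambda>\<omega>. \<Sum>j\<in>J. Y j \<omega> * h (V \<omega>) - Y j \<omega> * h (V \<omega> - Y j \<omega>))"
    proof (rule integral_mono)
      show "integrable M (\<lambda>\<omega>. indicator A \<omega> * \<eta> \<omega>)"
        using integrable_mult_indicator[OF _ int_\<eta>, of A] by simp
      show "integrable M (\<lambda>\<omega>. \<Sum>j\<in>J. Y j \<omega> * h (V \<omega>) - Y j \<omega> * h (V \<omega> - Y j \<omega>))"
        by (intro Bochner_Integration.integrable_sum Bochner_Integration.integrable_diff int_Yh) auto
      fix \<omega> assume "\<omega> \<in> space M"
      then have "indicator A \<omega> * \<eta> \<omega> = (\<Sum>j\<in>J. indicator {a..b} (V \<omega>) * \<zeta> (Y j \<omega>))"
        by (simp add: \<eta>_def sum_distrib_left A_def indicator_def)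
      also have "\<dots> \<le> (\<Sum>j\<in>J. Y j \<omega> * h (V \<omega>) - Y j \<omega> * h (V \<omega> - Y j \<omega>))"
        using clamp_increment[OF ab \<delta>] unfolding \<zeta>_def h_def K_def
        by (intro sum_mono) (simp add: right_diff_distrib)
      finally show "indicator A \<omega> * \<eta> \<omega> \<le> \<dots>" .
    qed
    also have "\<dots> = (\<Sum>j\<in>J. expectation (\<lambda>\<omega>. Y j \<omega> * h (V \<omega>)))"
      by (subst Bochner_Integration.integral_sum)
         (auto simp: int_Yh Bochner_Integration.integral_diff zero_term intro!: sum.cong)
    also have "\<dots> = expectation (\<lambda>\<omega>. V \<omega> * h (V \<omega>))"
      unfolding V_def sum_distrib_right
      by (rule Bochner_Integration.integral_sum[symmetric]) (rule int_Yh; simp)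
    also have "\<dots> \<le> expectation (\<lambda>\<omega>. K * \<bar>V \<omega>\<bar>)"
    proof (rule integral_mono)
      show "V \<omega> * h (V \<omega>) \<le> K * \<bar>V \<omega>\<bar>" for \<omega>
        using mult_mono[OF order_refl[of "\<bar>V \<omega>\<bar>"] h_bound[of "V \<omega>"]] abs_ge_self[of "V \<omega> * h (V \<omega>)"]
        by (simp add: abs_mult mult.commute)
      show "integrable M (\<lambda>\<omega>. V \<omega> * h (V \<omega>))"
        unfolding V_def sum_distrib_right by (rule Bochner_Integration.integrable_sum, rule int_Yh; simp)
    qed (use V in auto)
    also have "\<dots> \<le> K * sqrt s2"
      using expectation_abs_le_sqrt[OF V(1,2)] K V(3) by simp
    finally show ?thesis .
  qed
  have "prob A * (s2 / 2) \<le> prob A * expectation \<eta>" by (intro mult_left_mono mean_\<eta>) simp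
  also have "\<dots> = expectation (\<lambda>\<omega>. indicator A \<omega> * expectation \<eta>)"
    by simp
  \<comment> \<open>On A the mean of \<eta> is replaced by \<eta> itself; the price is the absolute
    deviation, everywhere.\<close>
  also have "\<dots> \<le> expectation (\<lambda>\<omega>. indicator A \<omega> * \<eta> \<omega> + \<bar>\<eta> \<omega> - expectation \<eta>\<bar>)"
  proof (rule integral_mono)
    show "integrable M (\<lambda>\<omega>. indicator A \<omega> * expectation \<eta>)" by (simp add: emeasure_finite less_top[symmetric])
    show "integrable M (\<lambda>\<omega>. indicator A \<omega> * \<eta> \<omega> + \<bar>\<eta> \<omega> - expectation \<eta>\<bar>)"
      using int_\<eta> integrable_mult_indicator[OF _ int_\<eta>, of A] by simp
  qed (auto simp: indicator_def)
  also have "\<dots> = expectation (\<lambda>\<omega>. indicator A \<omega> * \<eta> \<omega>) + expectation (\<lambda>\<omega>. \<bar>\<eta> \<omega> - expectation \<eta>\<bar>)"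
    using int_\<eta> integrable_mult_indicator[OF _ int_\<eta>, of A] by (intro Bochner_Integration.integral_add) auto
  also have "\<dots> \<le> K * sqrt s2 + \<delta> * sqrt s2" using upper dev_\<eta> by simp
  finally have "prob A * s2 \<le> (b - a + 2 * \<beta>) * sqrt s2"
    by (simp add: K_def \<delta>_def field_simps)
  then have "prob A * (sqrt s2 * sqrt s2) \<le> (b - a + 2 * \<beta>) * sqrt s2" using s2 by simp
  then have "prob A * sqrt s2 \<le> (b - a + 2 * \<beta>)"
    using s2 by (metis (no_types, opaque_lifting) mult.assoc mult_le_cancel_right real_sqrt_gt_zero not_less_iff_gr_or_eq order_less_le)
  then show ?thesis using s2 by (simp add: A_def V_def field_simps)
qed

end

section \<open>Stein's equation for intervals\<close>

definition stein_interval :: "real \<Rightarrow> real \<Rightarrow> real \<Rightarrow> real" where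
  "stein_interval a b w = stein b w - stein a w"

definition stein_interval_deriv :: "real \<Rightarrow> real \<Rightarrow> real \<Rightarrow> real" where
  "stein_interval_deriv a b w = stein_deriv b w - stein_deriv a w"

lemma borel_measurable_stein_interval [measurable]:
  "stein_interval a b \<in> borel_measurable borel"
  "stein_interval_deriv a b \<in> borel_measurable borel"
  unfolding stein_interval_def[abs_def] stein_interval_deriv_def[abs_def] by measurable

lemma abs_stein_interval_le: "\<bar>stein_interval a b w\<bar> \<le> sqrt (2 * pi) / 2"
  using stein_nonneg[of a w] stein_nonneg[of b w] stein_le[of a w] stein_le[of b w]
  unfolding stein_interval_def by linarith

lemma abs_stein_interval_deriv_le: "\<bar>stein_interval_deriv a b w\<bar> \<le> 2"
  using abs_stein_deriv_le[of a w] abs_stein_deriv_le[of b w]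
  by (simp add: stein_interval_deriv_def)

lemma stein_interval_deriv_eq:
  assumes "a \<le> b"
  shows "stein_interval_deriv a b w = w * stein_interval a b w + indicator {a<..b} w - (\<Phi> b - \<Phi> a)"
  using assms
  by (auto simp: stein_interval_deriv_def stein_interval_def stein_deriv_def algebra_simps indicator_def)

text \<open>The increments of w f_b(w) and w f_a(w) both lie in [0, m v], so either difference of
  them is at most m v. Moving right from v + s to v + t, the indicator of (a,b] can rise only by
  crossing a and fall only by crossing b; hence one endpoint for each sign.\<close>

lemma stein_interval_deriv_diff_le:
  assumes "a \<le> b" "s \<le> t"
  defines "m v \<equiv> min 1 ((\<bar>v\<bar> + sqrt (2 * pi) / 2) * (\<bar>s\<bar> + \<bar>t\<bar>))"
  shows "stein_interval_deriv a b (v + t) - stein_interval_deriv a b (v + s)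
      \<le> m v + indicator {a - t..a - s} v"
    and "stein_interval_deriv a b (v + s) - stein_interval_deriv a b (v + t)
      \<le> m v + indicator {b - t..b - s} v"
proof -
  define g where "g z = (v + t) * stein z (v + t) - (v + s) * stein z (v + s)" for z
  have g: "0 \<le> g z" "g z \<le> m v" for z
    using monoD[OF mono_mult_stein[of z], of "v + s" "v + t"] mult_stein_diff_le[OF assms(2), of v z]
      assms(2) by (auto simp: g_def m_def)
  have eq: "stein_interval_deriv a b (v + t) - stein_interval_deriv a b (v + s)
      = (g b - g a) + (indicator {a<..b} (v + t) - indicator {a<..b} (v + s))"
    unfolding stein_interval_deriv_eq[OF assms(1)] g_def stein_interval_def by (simp add: algebra_simps)
  have "indicator {a<..b} (v + t) - indicator {a<..b} (v + s) \<le> (indicator {a - t..a - s} v :: real)"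
    "indicator {a<..b} (v + s) - indicator {a<..b} (v + t) \<le> (indicator {b - t..b - s} v :: real)"
    using assms(1,2) by (auto simp: indicator_def)
  with eq g[of a] g[of b] show "stein_interval_deriv a b (v + t) - stein_interval_deriv a b (v + s)
      \<le> m v + indicator {a - t..a - s} v"
    "stein_interval_deriv a b (v + s) - stein_interval_deriv a b (v + t)
      \<le> m v + indicator {b - t..b - s} v"
    by linarith+
qed

text \<open>Collects what is used about the law \<nu> of W - Y_i. The slope c stems from its
  standard deviation, while \<kappa> leaves room for atoms: short intervals need not have small
  probability.\<close>

locale concentrated_distribution = real_distribution \<nu> for \<nu> :: "real measure" +
  fixes c \<kappa> :: real
  assumes integrable_ident: "integrable \<nu> (\<lambda>v. v)"
    and abs_moment_le_one: "(\<integral>v. \<bar>v\<bar> \<partial>\<nu>) \<le> 1"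
    and prob_Icc_le: "a \<le> b \<Longrightarrow> prob {a..b} \<le> c * (b - a) + \<kappa>"
    and c_nonneg: "0 \<le> c" and \<kappa>_nonneg: "0 \<le> \<kappa>"
begin

text \<open>The three contributions are the first absolute moment of \<nu>, the supremum of the
  Stein solution, and the concentration rate.\<close>

definition slope :: real where "slope = 1 + sqrt (2 * pi) / 2 + c"

text \<open>The mean of F(V + s) for V of law \<nu> and F the derivative of the Stein solution.
  Averaging turns the jumps of F into interval probabilities under \<nu>.\<close>

definition smoothed :: "real \<Rightarrow> real \<Rightarrow> real \<Rightarrow> real" where
  "smoothed a b s = (\<integral>v. stein_interval_deriv a b (v + s) \<partial>\<nu>)"

lemma integrable_stein_interval_deriv: "integrable \<nu> (\<lambda>v. stein_interval_deriv a b (v + s))"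
  by (rule integrable_const_bound[of _ 2]) (auto simp: abs_stein_interval_deriv_le)

lemma integrable_stein_interval: "integrable \<nu> (\<lambda>v. stein_interval a b (v + s))"
proof (rule integrable_const_bound)
  show "AE v in \<nu>. norm (stein_interval a b (v + s)) \<le> sqrt (2 * pi) / 2"
    unfolding real_norm_def by (intro AE_I2 abs_stein_interval_le)
qed simp

lemma borel_measurable_smoothed [measurable]: "smoothed a b \<in> borel_measurable borel"
  unfolding smoothed_def by measurable

lemma abs_smoothed_le: "\<bar>smoothed a b s\<bar> \<le> 2"
proof -
  have "norm (smoothed a b s) \<le> (\<integral>v. 2 \<partial>\<nu>)"
    unfolding smoothed_def
    by (rule Bochner_Integration.integral_norm_bound_integral)
       (auto simp: abs_stein_interval_deriv_le integrable_stein_interval_deriv)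
  then show ?thesis using prob_space by simp
qed

text \<open>The pointwise bounds are integrated over \<nu>: the first moment controls m,
  concentration controls the indicator. Using |s| + |t| in place of |t - s| allows the bound to be
  split later between the two arguments.\<close>

lemma smoothed_diff_le:
  assumes "a \<le> b"
  shows "\<bar>smoothed a b s - smoothed a b t\<bar> \<le> min 2 (slope * (\<bar>s\<bar> + \<bar>t\<bar>)) + \<kappa>"
proof -
  have *: "\<bar>smoothed a b s - smoothed a b t\<bar> \<le> min 2 (slope * (\<bar>s\<bar> + \<bar>t\<bar>)) + \<kappa>" if "s \<le> t" for s t
  proof -
    define r where "r = \<bar>s\<bar> + \<bar>t\<bar>"
    define m where "m v = min 1 ((\<bar>v\<bar> + sqrt (2 * pi) / 2) * r)" for v
    have r: "0 \<le> r" by (simp add: r_def)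
    have int_lin: "integrable \<nu> (\<lambda>v. (\<bar>v\<bar> + sqrt (2 * pi) / 2) * r)"
      using integrable_ident by auto
    have int_m: "integrable \<nu> m"
      by (rule integrable_const_bound[of _ 1]) (use r in \<open>auto simp: m_def[abs_def]\<close>)
    have "(\<integral>v. m v \<partial>\<nu>) \<le> (\<integral>v. 1 \<partial>\<nu>)" "(\<integral>v. m v \<partial>\<nu>) \<le> (\<integral>v. (\<bar>v\<bar> + sqrt (2 * pi) / 2) * r \<partial>\<nu>)"
      by (intro integral_mono int_m int_lin; simp add: m_def)+
    moreover have "(\<integral>v. (\<bar>v\<bar> + sqrt (2 * pi) / 2) * r \<partial>\<nu>) \<le> (1 + sqrt (2 * pi) / 2) * r"
      using integrable_ident abs_moment_le_one r prob_space by (auto intro!: mult_right_mono)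
    ultimately have m: "(\<integral>v. m v \<partial>\<nu>) \<le> min 1 ((1 + sqrt (2 * pi) / 2) * r)"
      using prob_space by auto
    have conc: "prob {x - t..x - s} \<le> min 1 (c * r + \<kappa>)" for x
    proof -
      have "prob {x - t..x - s} \<le> c * (t - s) + \<kappa>"
        using prob_Icc_le[of "x - t" "x - s"] that by simp
      also have "c * (t - s) \<le> c * r" using c_nonneg by (intro mult_left_mono) (auto simp: r_def)
      finally show ?thesis by simp
    qed
    have 1: "\<bar>smoothed a b s - smoothed a b t\<bar> \<le> (\<integral>v. m v \<partial>\<nu>) + min 1 (c * r + \<kappa>)"
    proof -
      have "smoothed a b t - smoothed a b s = (\<integral>v. stein_interval_deriv a b (v + t) - stein_interval_deriv a b (v + s) \<partial>\<nu>)"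
        unfolding smoothed_def by (simp add: integrable_stein_interval_deriv)
      also have "\<dots> \<le> (\<integral>v. m v + indicator {a - t..a - s} v \<partial>\<nu>)"
        by (rule integral_mono)
           (use stein_interval_deriv_diff_le(1)[OF assms that, folded r_def, folded m_def] int_m in
             \<open>simp_all add: integrable_stein_interval_deriv emeasure_finite less_top[symmetric]\<close>)
      also have "\<dots> = (\<integral>v. m v \<partial>\<nu>) + prob {a - t..a - s}"
        using int_m by (subst Bochner_Integration.integral_add) (simp_all add: emeasure_finite less_top[symmetric])
      finally have A: "smoothed a b t - smoothed a b s \<le> (\<integral>v. m v \<partial>\<nu>) + prob {a - t..a - s}" .
      have "smoothed a b s - smoothed a b t = (\<integral>v. stein_interval_deriv a b (v + s) - stein_interval_deriv a b (v + t) \<partial>\<nu>)"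
        unfolding smoothed_def by (simp add: integrable_stein_interval_deriv)
      also have "\<dots> \<le> (\<integral>v. m v + indicator {b - t..b - s} v \<partial>\<nu>)"
        by (rule integral_mono)
           (use stein_interval_deriv_diff_le(2)[OF assms that, folded r_def, folded m_def] int_m in
             \<open>simp_all add: integrable_stein_interval_deriv emeasure_finite less_top[symmetric]\<close>)
      also have "\<dots> = (\<integral>v. m v \<partial>\<nu>) + prob {b - t..b - s}"
        using int_m by (subst Bochner_Integration.integral_add) (simp_all add: emeasure_finite less_top[symmetric])
      finally have B: "smoothed a b s - smoothed a b t \<le> (\<integral>v. m v \<partial>\<nu>) + prob {b - t..b - s}" .
      show ?thesis using A B conc[of a] conc[of b] by linarith
    qed
    have "(1 + sqrt (2 * pi) / 2) * r + c * r = slope * r" by (simp add: slope_def algebra_simps)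
    \<comment> \<open>The two caps at 1, for m and for the probability, add up to the cap 2;
      \<kappa> stays outside the minimum.\<close>
    with 1 m \<kappa>_nonneg show ?thesis unfolding r_def[symmetric] by linarith
  qed
  show ?thesis using *[of s t] *[of t s] by (cases "s \<le> t") (auto simp: abs_minus_commute add.commute)
qed

text \<open>The fundamental theorem for each fixed v, followed by Fubini; boundedness of the
  derivative on the compact range of t gives integrability.\<close>

lemma stein_interval_diff_integral:
  assumes "p \<le> q"
  shows "(\<integral>v. stein_interval a b (v + q) - stein_interval a b (v + p) \<partial>\<nu>) = (LBINT t:{p..q}. smoothed a b t)"
proof -
  interpret P: pair_sigma_finite \<nu> lborel ..
  define F where "F v t = indicator {p..q} t *\<^sub>R stein_interval_deriv a b (v + t)" for v t :: real
  have [measurable]: "case_prod F \<in> borel_measurable (\<nu> \<Otimes>\<^sub>M lborel)"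
    unfolding F_def by measurable
  have int_ind: "integrable lborel (\<lambda>t. indicator {p..q} t :: real)"
    by (simp add: integrable_indicator_iff emeasure_lborel_Icc_eq)
  have int_F: "integrable (\<nu> \<Otimes>\<^sub>M lborel) (case_prod F)"
  proof (rule Bochner_Integration.integrable_bound)
    show "integrable (\<nu> \<Otimes>\<^sub>M lborel) (\<lambda>(v, t). 2 * indicator {p..q} t :: real)"
      by (rule P.Fubini_integrable) (use int_ind in auto)
  qed (auto simp: F_def indicator_def abs_stein_interval_deriv_le)
  have shift: "stein z (v + q) - stein z (v + p) = (LBINT t:{p..q}. stein_deriv z (v + t))" for z v
  proof -
    have "stein z (v + q) - stein z (v + p) = (LBINT t:{v + p..v + q}. stein_deriv z t)"
      using assms by (intro stein_diff_eq_integral) simp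
    also have "\<dots> = (LBINT t:{p..q}. stein_deriv z (v + t))"
      unfolding set_lebesgue_integral_def
      by (subst lborel_integral_real_affine[of 1 _ v]) (auto simp: indicator_def intro!: Bochner_Integration.integral_cong)
    finally show ?thesis .
  qed
  have int_shift: "set_integrable lborel {p..q} (\<lambda>t. stein_deriv z (v + t))" for z v
    unfolding set_integrable_def
    by (rule Bochner_Integration.integrable_bound[OF int_ind]) (auto simp: indicator_def abs_stein_deriv_le)
  have "(\<integral>v. stein_interval a b (v + q) - stein_interval a b (v + p) \<partial>\<nu>) = (\<integral>v. (\<integral>t. F v t \<partial>lborel) \<partial>\<nu>)"
  proof (rule Bochner_Integration.integral_cong[OF refl])
    fix v
    have "stein_interval a b (v + q) - stein_interval a b (v + p) =
        (LBINT t:{p..q}. stein_deriv b (v + t)) - (LBINT t:{p..q}. stein_deriv a (v + t))"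
      unfolding shift[symmetric] stein_interval_def by simp
    also have "\<dots> = (LBINT t:{p..q}. stein_interval_deriv a b (v + t))"
      unfolding stein_interval_deriv_def by (rule set_integral_diff(2)[symmetric]) (rule int_shift)+
    finally show "stein_interval a b (v + q) - stein_interval a b (v + p) = (\<integral>t. F v t \<partial>lborel)"
      by (simp add: F_def set_lebesgue_integral_def)
  qed
  also have "\<dots> = (\<integral>t. (\<integral>v. F v t \<partial>\<nu>) \<partial>lborel)"
    by (rule P.Fubini_integral[OF int_F, symmetric])
  also have "\<dots> = (LBINT t:{p..q}. smoothed a b t)"
    unfolding F_def smoothed_def set_lebesgue_integral_def by simp
  finally show ?thesis .
qed

text \<open>The bound on the deviation from e is integrated between 0 and y. Up to length 1 the
  linear part is used, beyond it the cap 2.\<close>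

lemma smoothed_integral_deviation:
  assumes slope: "2 \<le> slope" "slope \<le> 4" and dev: "\<And>t. \<bar>smoothed a b t - e\<bar> \<le> min 2 (slope * \<bar>t\<bar>) + k"
  shows "\<bar>(\<integral>v. stein_interval a b (v + y) - stein_interval a b v \<partial>\<nu>) - y * e\<bar>
    \<le> \<bar>y\<bar> * (k + 2 * min 1 \<bar>y\<bar>)"
proof -
  have int_ind: "integrable lborel (\<lambda>t. indicator {p..q} t :: real)" for p q :: real
    by (simp add: integrable_indicator_iff emeasure_lborel_Icc_eq)
  have int_sm: "integrable lborel (\<lambda>t. indicator {p..q} t * smoothed a b t)" for p q
    by (rule Bochner_Integration.integrable_bound[of _ "\<lambda>t. 2 * indicator {p..q} t"])
       (use int_ind[of p q] abs_smoothed_le in \<open>auto simp: indicator_def\<close>)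
  have *: "\<bar>(LBINT t:{p..q}. smoothed a b t) - r * e\<bar> \<le> r * (k + 2 * min 1 r)"
    if "p \<le> q" "r = q - p" "p = 0 \<or> q = 0" for p q r
  proof -
    have int_D: "integrable lborel (\<lambda>t. indicator {p..q} t * (smoothed a b t - e))"
      using int_sm[of p q] int_ind[of p q] by (simp add: right_diff_distrib)
    have "(LBINT t:{p..q}. smoothed a b t) - r * e = (LBINT t. indicator {p..q} t * (smoothed a b t - e))"
      using int_sm[of p q] int_ind[of p q] that by (simp add: right_diff_distrib set_lebesgue_integral_def)
    moreover have "\<bar>LBINT t. indicator {p..q} t * (smoothed a b t - e)\<bar> \<le> r * (k + 2 * min 1 r)"
    proof (cases "r \<le> 1")
      case False
      have "norm (LBINT t. indicator {p..q} t * (smoothed a b t - e)) \<le> (LBINT t. (k + 2) * indicator {p..q} t)"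
      proof (rule Bochner_Integration.integral_norm_bound_integral[OF int_D])
        show "norm (indicator {p..q} t * (smoothed a b t - e)) \<le> (k + 2) * indicator {p..q} t" for t
          using dev[of t] by (auto simp: indicator_def)
      qed (use int_ind in simp)
      then show ?thesis using False that by (simp add: mult.commute)
    next
      \<comment> \<open>The interval has 0 as an endpoint, so |t| is t or -t throughout and has an
        explicit antiderivative.\<close>
      case True
      have lin: "has_bochner_integral lborel (\<lambda>t. (k + slope * \<bar>t\<bar>) * indicator {p..q} t) (k * r + slope * r\<^sup>2 / 2)"
      proof (rule has_bochner_integral_cong[THEN iffD1, rotated -1])
        show "has_bochner_integral lborel (\<lambda>t. (k + slope * ((if p = 0 then 1 else - 1) * t)) * indicator {p..q} t)
          ((k * q + slope * (if p = 0 then 1 else -1) * q\<^sup>2 / 2) - (k * p + slope * (if p = 0 then 1 else -1) * p\<^sup>2 / 2))"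
          by (rule has_bochner_integral_FTC_Icc_real[OF that(1)])
             (auto intro!: derivative_eq_intros continuous_intros)
      qed (use that in \<open>auto simp: indicator_def power2_eq_square\<close>)
      have "norm (LBINT t. indicator {p..q} t * (smoothed a b t - e)) \<le> (LBINT t. (k + slope * \<bar>t\<bar>) * indicator {p..q} t)"
      proof (rule Bochner_Integration.integral_norm_bound_integral[OF int_D integrable.intros[OF lin]])
        show "norm (indicator {p..q} t * (smoothed a b t - e)) \<le> (k + slope * \<bar>t\<bar>) * indicator {p..q} t" for t
          using dev[of t] by (auto simp: indicator_def)
      qed
      also have "\<dots> = k * r + slope * r\<^sup>2 / 2" by (rule has_bochner_integral_integral_eq[OF lin])
      \<comment> \<open>Raising the slope to 4 gives the constant 2 that the cap yields for r > 1,
        so one expression with a minimum serves both ranges.\<close>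
      also have "\<dots> \<le> k * r + 4 * r\<^sup>2 / 2"
        using slope by (intro add_left_mono divide_right_mono mult_right_mono) auto
      also have "\<dots> = r * (k + 2 * min 1 r)" using True by (simp add: algebra_simps power2_eq_square)
      finally show ?thesis by simp
    qed
    ultimately show ?thesis by simp
  qed
  show ?thesis
  proof (cases "0 \<le> y")
    case True
    then show ?thesis using *[of 0 y y] stein_interval_diff_integral[of 0 y a b] by simp
  next
    case False
    have "(\<integral>v. stein_interval a b (v + y) - stein_interval a b v \<partial>\<nu>) = - (LBINT t:{y..0}. smoothed a b t)"
      using stein_interval_diff_integral[of y 0 a b] False integrable_stein_interval[of a b 0]
        integrable_stein_interval[of a b y] by simp
    then show ?thesis using *[of y 0 "- y"] False by (simp add: abs_minus_commute)
  qed
qed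

text \<open>Here \<mu> is the law of one summand and e the mean of F at the full sum, the second
  argument being an independent summand. Averaging \<open>smoothed_diff_le\<close> over that summand
  yields k; the integral up to y, multiplied by y, then leaves E Y^2 and the truncated second
  moment.\<close>

lemma stein_term_bound:
  assumes \<mu>: "real_distribution \<mu>" and ab: "a \<le> b" and slope: "2 \<le> slope" "slope \<le> 4"
    and sq: "integrable \<mu> (\<lambda>y. y\<^sup>2)"
    and trunc2: "(\<integral>y. y\<^sup>2 * min 1 \<bar>y\<bar> \<partial>\<mu>) \<le> \<beta> * (\<integral>y. y\<^sup>2 \<partial>\<mu>)"
    and trunc0: "(\<integral>y. min 1 \<bar>y\<bar> \<partial>\<mu>) \<le> \<beta>"
  shows "\<bar>(\<integral>y. y * (\<integral>v. stein_interval a b (v + y) - stein_interval a b v \<partial>\<nu>) \<partial>\<mu>)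
      - (\<integral>y. y\<^sup>2 \<partial>\<mu>) * (\<integral>y. smoothed a b y \<partial>\<mu>)\<bar> \<le> ((slope + 2) * \<beta> + \<kappa>) * (\<integral>y. y\<^sup>2 \<partial>\<mu>)"
proof -
  interpret \<mu>: real_distribution \<mu> by (rule \<mu>)
  define G where "G y = (\<integral>v. stein_interval a b (v + y) - stein_interval a b v \<partial>\<nu>)" for y
  define e where "e = (\<integral>y. smoothed a b y \<partial>\<mu>)"
  define k where "k = slope * \<beta> + \<kappa>"
  have [measurable]: "G \<in> borel_measurable borel" unfolding G_def by measurable
  have int_y: "integrable \<mu> (\<lambda>y. y)" using \<mu>.integrable_of_square[of "\<lambda>y. y"] sq by simp
  have int_sm: "integrable \<mu> (smoothed a b)"
    by (rule \<mu>.integrable_const_bound[of _ 2]) (auto simp: abs_smoothed_le)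
  have int_min: "integrable \<mu> (\<lambda>y. min 1 \<bar>y\<bar>)"
    by (rule \<mu>.integrable_const_bound[of _ 1]) auto
  have int_min2: "integrable \<mu> (\<lambda>y. y\<^sup>2 * min 1 \<bar>y\<bar>)"
    by (rule Bochner_Integration.integrable_bound[OF sq]) (auto simp: abs_mult intro!: mult_left_le)
  have dev: "\<bar>smoothed a b t - e\<bar> \<le> min 2 (slope * \<bar>t\<bar>) + k" for t
  proof -
    have "smoothed a b t - e = (\<integral>y. smoothed a b t - smoothed a b y \<partial>\<mu>)"
      using int_sm \<mu>.prob_space by (simp add: e_def)
    also have "norm \<dots> \<le> (\<integral>y. (min 2 (slope * \<bar>t\<bar>) + \<kappa>) + slope * min 1 \<bar>y\<bar> \<partial>\<mu>)"
    proof (rule Bochner_Integration.integral_norm_bound_integral)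
      fix y
      \<comment> \<open>Splitting the minimum is what lets truncated moments suffice: for |y| > 1
        the summand \<open>slope\<close> alone is at least the cap 2.\<close>
      have "min 2 (slope * (\<bar>t\<bar> + \<bar>y\<bar>)) \<le> min 2 (slope * \<bar>t\<bar>) + slope * min 1 \<bar>y\<bar>"
      proof (cases "\<bar>y\<bar> \<le> 1")
        case True
        have "0 \<le> slope * \<bar>y\<bar>" using slope by simp
        with True show ?thesis by (simp add: distrib_left min_def)
      next
        case False
        have "0 \<le> slope * \<bar>t\<bar>" using slope by simp
        moreover have "slope * min 1 \<bar>y\<bar> = slope" using False by simp
        ultimately show ?thesis using slope by linarith
      qed
      with smoothed_diff_le[OF ab, of t y]
      show "norm (smoothed a b t - smoothed a b y) \<le> (min 2 (slope * \<bar>t\<bar>) + \<kappa>) + slope * min 1 \<bar>y\<bar>" by simp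
    qed (use int_sm int_min in auto)
    also have "\<dots> = min 2 (slope * \<bar>t\<bar>) + \<kappa> + slope * (\<integral>y. min 1 \<bar>y\<bar> \<partial>\<mu>)"
      using int_min \<mu>.prob_space by simp
    also have "\<dots> \<le> min 2 (slope * \<bar>t\<bar>) + \<kappa> + slope * \<beta>"
      using slope trunc0 by (intro add_left_mono mult_left_mono) auto
    finally show ?thesis by (simp add: k_def)
  qed
  note G = smoothed_integral_deviation[OF slope dev, folded G_def]
  have pt: "\<bar>y * (G y - y * e)\<bar> \<le> k * y\<^sup>2 + 2 * (y\<^sup>2 * min 1 \<bar>y\<bar>)" for y
  proof -
    have "\<bar>y * (G y - y * e)\<bar> \<le> \<bar>y\<bar> * (\<bar>y\<bar> * (k + 2 * min 1 \<bar>y\<bar>))"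
      unfolding abs_mult by (intro mult_left_mono G) auto
    also have "\<dots> = \<bar>y\<bar>\<^sup>2 * (k + 2 * min 1 \<bar>y\<bar>)" by (simp add: power2_eq_square)
    finally show ?thesis by (simp add: algebra_simps)
  qed
  have int_bound: "integrable \<mu> (\<lambda>y. k * y\<^sup>2 + 2 * (y\<^sup>2 * min 1 \<bar>y\<bar>))"
    using sq int_min2 by auto
  have int_D: "integrable \<mu> (\<lambda>y. y * (G y - y * e))"
  proof (rule Bochner_Integration.integrable_bound[OF int_bound])
    show "AE y in \<mu>. norm (y * (G y - y * e)) \<le> norm (k * y\<^sup>2 + 2 * (y\<^sup>2 * min 1 \<bar>y\<bar>))"
      unfolding real_norm_def by (intro AE_I2 order.trans[OF pt abs_ge_self])
  qed auto
  \<comment> \<open>Integrability of y G(y) is recovered from that of y (G(y) - y e) by adding back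
    e y^2.\<close>
  have "integrable \<mu> (\<lambda>y. y * (G y - y * e) + e * y\<^sup>2)"
    using int_D sq by auto
  then have int_yG: "integrable \<mu> (\<lambda>y. y * G y)" by (simp add: algebra_simps power2_eq_square)
  have "(\<integral>y. y * G y \<partial>\<mu>) - (\<integral>y. y\<^sup>2 \<partial>\<mu>) * e = (\<integral>y. y * G y - y\<^sup>2 * e \<partial>\<mu>)"
    using int_yG sq by simp
  also have "\<dots> = (\<integral>y. y * (G y - y * e) \<partial>\<mu>)" by (simp add: algebra_simps power2_eq_square)
  also have "norm \<dots> \<le> (\<integral>y. k * y\<^sup>2 + 2 * (y\<^sup>2 * min 1 \<bar>y\<bar>) \<partial>\<mu>)"
    by (rule Bochner_Integration.integral_norm_bound_integral[OF int_D int_bound]) (use pt in simp)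
  also have "\<dots> = k * (\<integral>y. y\<^sup>2 \<partial>\<mu>) + 2 * (\<integral>y. y\<^sup>2 * min 1 \<bar>y\<bar> \<partial>\<mu>)"
    using sq int_min2 by simp
  also have "\<dots> \<le> k * (\<integral>y. y\<^sup>2 \<partial>\<mu>) + 2 * (\<beta> * (\<integral>y. y\<^sup>2 \<partial>\<mu>))" using trunc2 by simp
  also have "\<dots> = ((slope + 2) * \<beta> + \<kappa>) * (\<integral>y. y\<^sup>2 \<partial>\<mu>)" by (simp add: k_def algebra_simps)
  finally show ?thesis by (simp add: G_def e_def)
qed

end

section \<open>Sums of independent variables\<close>

context prob_space begin

text \<open>Chebyshev's association inequality, comparing with the level $\sqrt{\mathsf{E}Z^2}$ of $|Z|$.\<close>
lemma expectation_square_times_truncation_le: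
  fixes Z :: "'a \<Rightarrow> real"
  assumes [measurable]: "random_variable borel Z" and sq: "integrable M (\<lambda>\<omega>. (Z \<omega>)\<^sup>2)"
  shows "expectation (\<lambda>\<omega>. (Z \<omega>)\<^sup>2) * expectation (\<lambda>\<omega>. min 1 \<bar>Z \<omega>\<bar>)
    \<le> expectation (\<lambda>\<omega>. (Z \<omega>)\<^sup>2 * min 1 \<bar>Z \<omega>\<bar>)"
proof -
  define v where "v = expectation (\<lambda>\<omega>. (Z \<omega>)\<^sup>2)"
  define l where "l = min 1 (sqrt v)"
  have v: "0 \<le> v" unfolding v_def by (rule Bochner_Integration.integral_nonneg) simp
  have int0: "integrable M (\<lambda>\<omega>. min 1 \<bar>Z \<omega>\<bar>)"
    by (rule integrable_const_bound[of _ 1]) auto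
  have int2: "integrable M (\<lambda>\<omega>. (Z \<omega>)\<^sup>2 * min 1 \<bar>Z \<omega>\<bar>)"
    by (rule Bochner_Integration.integrable_bound[OF sq]) (auto simp: abs_mult intro!: mult_left_le)
  have pt: "0 \<le> (z\<^sup>2 - v) * (min 1 \<bar>z\<bar> - l)" for z :: real
  proof (cases "\<bar>z\<bar> \<le> sqrt v")
    case True
    then have "z\<^sup>2 \<le> v" using v by (metis abs_le_square_iff abs_of_nonneg real_sqrt_ge_zero real_sqrt_pow2)
    moreover have "min 1 \<bar>z\<bar> \<le> l" using True by (auto simp: l_def)
    ultimately show ?thesis by (simp add: mult_nonpos_nonpos)
  next
    case False
    then have "v \<le> z\<^sup>2" using v real_le_lsqrt[of v "\<bar>z\<bar>"]
      by (metis abs_ge_zero linear power2_abs real_sqrt_le_iff real_sqrt_abs)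
    moreover have "l \<le> min 1 \<bar>z\<bar>" using False by (auto simp: l_def)
    ultimately show ?thesis by simp
  qed
  have eq: "((Z \<omega>)\<^sup>2 - v) * (min 1 \<bar>Z \<omega>\<bar> - l) =
      (Z \<omega>)\<^sup>2 * min 1 \<bar>Z \<omega>\<bar> - v * min 1 \<bar>Z \<omega>\<bar> - l * (Z \<omega>)\<^sup>2 + l * v" for \<omega>
    by (simp add: algebra_simps)
  have "0 \<le> expectation (\<lambda>\<omega>. ((Z \<omega>)\<^sup>2 - v) * (min 1 \<bar>Z \<omega>\<bar> - l))"
    by (rule Bochner_Integration.integral_nonneg) (rule pt)
  also have "\<dots> = expectation (\<lambda>\<omega>. (Z \<omega>)\<^sup>2 * min 1 \<bar>Z \<omega>\<bar>) - v * expectation (\<lambda>\<omega>. min 1 \<bar>Z \<omega>\<bar>)"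
    unfolding eq using int0 int2 sq by (simp add: prob_space v_def)
  finally show ?thesis by (simp add: v_def)
qed

text \<open>Independence makes the joint law a product, so Fubini integrates out V for each fixed
  value of Y.\<close>

lemma indep_var_expectation_iterated:
  fixes V Y :: "'a \<Rightarrow> real" and g :: "real \<Rightarrow> real \<Rightarrow> real"
  assumes ind: "indep_var borel Y borel V"
    and [measurable]: "case_prod g \<in> borel_measurable (borel \<Otimes>\<^sub>M borel)"
    and int: "integrable M (\<lambda>\<omega>. g (Y \<omega>) (V \<omega>))"
  shows "expectation (\<lambda>\<omega>. g (Y \<omega>) (V \<omega>)) = (\<integral>y. (\<integral>v. g y v \<partial>distr M borel V) \<partial>distr M borel Y)"
proof -
  have [measurable]: "random_variable borel Y" "random_variable borel V"
    using ind by (auto dest: indep_var_rv1 indep_var_rv2)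
  interpret Y: prob_space "distr M borel Y" by (rule prob_space_distr) simp
  interpret V: prob_space "distr M borel V" by (rule prob_space_distr) simp
  interpret P: pair_prob_space "distr M borel Y" "distr M borel V" ..
  have eq: "distr M borel Y \<Otimes>\<^sub>M distr M borel V = distr M (borel \<Otimes>\<^sub>M borel) (\<lambda>\<omega>. (Y \<omega>, V \<omega>))"
    using ind indep_var_distribution_eq by blast
  have "integrable (distr M borel Y \<Otimes>\<^sub>M distr M borel V) (case_prod g)"
    unfolding eq by (subst integrable_distr_eq) (use int in auto)
  from P.integral_fst[OF this]
  have "(\<integral>y. (\<integral>v. g y v \<partial>distr M borel V) \<partial>distr M borel Y)
    = integral\<^sup>L (distr M (borel \<Otimes>\<^sub>M borel) (\<lambda>\<omega>. (Y \<omega>, V \<omega>))) (case_prod g)"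
    by (simp add: eq)
  also have "\<dots> = expectation (\<lambda>\<omega>. g (Y \<omega>) (V \<omega>))"
    by (subst integral_distr) auto
  finally show ?thesis by simp
qed

lemma normalized_sum_interval_bound:
  fixes Y :: "'i \<Rightarrow> 'a \<Rightarrow> real"
  assumes fin: "finite I" and card: "41 \<le> card I" and ind: "indep_vars (\<lambda>_. borel) Y I"
    and zero: "\<And>i. i \<in> I \<Longrightarrow> expectation (Y i) = 0"
    and sq: "\<And>i. i \<in> I \<Longrightarrow> integrable M (\<lambda>\<omega>. (Y i \<omega>)\<^sup>2)"
    and var: "\<And>i. i \<in> I \<Longrightarrow> expectation (\<lambda>\<omega>. (Y i \<omega>)\<^sup>2) = 1 / card I"
    and trunc: "\<And>i. i \<in> I \<Longrightarrow> expectation (\<lambda>\<omega>. (Y i \<omega>)\<^sup>2 * min 1 \<bar>Y i \<omega>\<bar>) \<le> \<beta> / card I"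
    and \<beta>: "0 < \<beta>" "\<beta> \<le> 1/2" and ab: "a \<le> b"
  shows "\<bar>prob {\<omega> \<in> space M. a < (\<Sum>i\<in>I. Y i \<omega>) \<and> (\<Sum>i\<in>I. Y i \<omega>) \<le> b} - (\<Phi> b - \<Phi> a)\<bar>
    \<le> 7.4184 * \<beta>"
proof -
  define n where "n = real (card I)"
  \<comment> \<open>1.0125^2 = 1.02515625 exceeds 41/40, so c bounds the reciprocal standard
    deviation of W - Y_i for all n from 41 on.\<close>
  define c :: real where "c = 1.0125"
  \<comment> \<open>The part of (y - x + 2\<beta>) / \<open>sqrt s2\<close> that does not shrink
    with the interval.\<close>
  define \<kappa> where "\<kappa> = 2 * c * \<beta>"
  define C where "C = (3 + sqrt (2 * pi) / 2 + c) * \<beta> + \<kappa>"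
  define f where "f = stein_interval a b"
  define F where "F = stein_interval_deriv a b"
  define W where "W \<omega> = (\<Sum>i\<in>I. Y i \<omega>)" for \<omega>
  define V where "V i \<omega> = (\<Sum>j\<in>I - {i}. Y j \<omega>)" for i \<omega>
  have n: "41 \<le> n" using card by (simp add: n_def)
  have [measurable]: "\<And>i. i \<in> I \<Longrightarrow> random_variable borel (Y i)"
    using ind by (auto simp: indep_vars_def)
  have [measurable]: "random_variable borel W" unfolding W_def by measurable
  have [measurable]: "random_variable borel (V i)" for i unfolding V_def by measurable
  have [measurable]: "f \<in> borel_measurable borel" "F \<in> borel_measurable borel"
    by (simp_all add: f_def F_def)
  have int: "integrable M (Y i)" if "i \<in> I" for i
    using integrable_of_square[OF _ sq] that by auto
  have W_eq: "W \<omega> = V i \<omega> + Y i \<omega>" if "i \<in> I" for i \<omega>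
    using fin that by (simp add: W_def V_def sum.remove)
  have sqrt2pi: "1 \<le> sqrt (2 * pi) / 2" "sqrt (2 * pi) / 2 \<le> 1.35"
  proof -
    have "sqrt (2\<^sup>2) \<le> sqrt (2 * pi)" using pi_gt3 by (intro real_sqrt_le_mono) simp
    then show "1 \<le> sqrt (2 * pi) / 2" by simp
    have "sqrt (2 * pi) \<le> sqrt (2.7\<^sup>2)" using pi_less_4 pi_approx by (intro real_sqrt_le_mono) (simp add: power2_eq_square)
    then show "sqrt (2 * pi) / 2 \<le> 1.35" by simp
  qed
  have int_Yf: "integrable M (\<lambda>\<omega>. Y i \<omega> * f (U \<omega>))"
    if "i \<in> I" and [measurable]: "random_variable borel U" for i U
  proof (rule Bochner_Integration.integrable_bound)
    show "integrable M (\<lambda>\<omega>. sqrt (2 * pi) / 2 * \<bar>Y i \<omega>\<bar>)" using int that by simp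
    show "AE \<omega> in M. norm (Y i \<omega> * f (U \<omega>)) \<le> norm (sqrt (2 * pi) / 2 * \<bar>Y i \<omega>\<bar>)"
    proof (rule AE_I2)
      fix \<omega>
      show "norm (Y i \<omega> * f (U \<omega>)) \<le> norm (sqrt (2 * pi) / 2 * \<bar>Y i \<omega>\<bar>)"
        using mult_right_mono[OF abs_stein_interval_le[of a b "U \<omega>"] abs_ge_zero[of "Y i \<omega>"]]
        by (simp add: f_def abs_mult mult.commute)
    qed
  qed (use that in auto)
  have int_F: "integrable M (\<lambda>\<omega>. F (U \<omega>))" if [measurable]: "random_variable borel U" for U
    by (rule integrable_const_bound[of _ 2]) (auto simp: F_def abs_stein_interval_deriv_le)
  \<comment> \<open>E F(W) is shared out in equal parts because every summand has variance
    1/n.\<close>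
  have summand: "\<bar>expectation (\<lambda>\<omega>. F (W \<omega>)) / n - expectation (\<lambda>\<omega>. Y i \<omega> * f (W \<omega>))\<bar> \<le> C / n"
    if i: "i \<in> I" for i
  proof -
    let ?\<nu> = "distr M borel (V i)" and ?\<mu> = "distr M borel (Y i)"
    define s2 where "s2 = (n - 1) / n"
    have card_J: "real (card (I - {i})) = n - 1"
      using i fin card by (simp add: n_def of_nat_diff card_Diff_singleton)
    have s2: "s2 = (\<Sum>j\<in>I - {i}. expectation (\<lambda>\<omega>. (Y j \<omega>)\<^sup>2))" "0 < s2" "s2 \<le> 1" "1 / sqrt s2 \<le> c"
    proof -
      show "s2 = (\<Sum>j\<in>I - {i}. expectation (\<lambda>\<omega>. (Y j \<omega>)\<^sup>2))"
      proof -
        have "(\<Sum>j\<in>I - {i}. expectation (\<lambda>\<omega>. (Y j \<omega>)\<^sup>2)) = (\<Sum>j\<in>I - {i}. 1 / n)"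
          by (rule sum.cong) (auto simp: var n_def)
        then show ?thesis unfolding sum_constant card_J by (simp add: s2_def)
      qed
      show "0 < s2" "s2 \<le> 1" using n by (simp_all add: s2_def)
      have "1 / c \<le> sqrt s2"
        using n by (intro real_le_rsqrt) (simp add: c_def s2_def power2_eq_square field_simps)
      then show "1 / sqrt s2 \<le> c" using \<open>0 < s2\<close> by (simp add: c_def field_simps)
    qed
    have indJ: "indep_vars (\<lambda>_. borel) Y (I - {i})" by (rule indep_vars_subset[OF ind]) auto
    have V_moments: "integrable M (V i)" "integrable M (\<lambda>\<omega>. (V i \<omega>)\<^sup>2)" "expectation (\<lambda>\<omega>. (V i \<omega>)\<^sup>2) = s2"
    proof -
      have "integrable M (\<lambda>\<omega>. (V i \<omega>)\<^sup>2) \<and> expectation (\<lambda>\<omega>. (V i \<omega>)\<^sup>2) = s2"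
        unfolding V_def s2(1)
        by (rule expectation_square_sum[OF _ indJ]) (simp_all add: fin int zero sq)
      then show "integrable M (\<lambda>\<omega>. (V i \<omega>)\<^sup>2)" "expectation (\<lambda>\<omega>. (V i \<omega>)\<^sup>2) = s2" by simp_all
      show "integrable M (V i)"
        unfolding V_def by (rule Bochner_Integration.integrable_sum) (simp add: int)
    qed
    interpret \<nu>: concentrated_distribution ?\<nu> c \<kappa>
    proof (intro concentrated_distribution.intro concentrated_distribution_axioms.intro)
      show "real_distribution ?\<nu>" by simp
      show "integrable ?\<nu> (\<lambda>v. v)" by (subst integrable_distr_eq) (use V_moments in auto)
      have "expectation (\<lambda>\<omega>. \<bar>V i \<omega>\<bar>) \<le> sqrt s2"
        using expectation_abs_le_sqrt[OF V_moments(1,2)] V_moments(3) by simp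
      also have "\<dots> \<le> 1" using s2 by simp
      finally show "(\<integral>v. \<bar>v\<bar> \<partial>?\<nu>) \<le> 1" by (subst integral_distr) auto
      show "0 \<le> c" "0 \<le> \<kappa>" using \<beta> by (auto simp: c_def \<kappa>_def)
      fix x y :: real assume xy: "x \<le> y"
      have "measure ?\<nu> {x..y} = prob {\<omega> \<in> space M. x \<le> V i \<omega> \<and> V i \<omega> \<le> y}"
        by (subst measure_distr) (auto intro!: arg_cong[where f = prob])
      also have "\<dots> \<le> (y - x + 2 * \<beta>) / sqrt s2"
        unfolding V_def
      proof (rule prob_sum_in_interval_le[OF _ indJ sq zero s2(1,2) _ \<beta> xy])
        \<comment> \<open>The n - 1 remaining terms contribute (n-1)\<beta>/n, which is exactly
          \<beta> times their variance s2: no loss occurs in the relative form.\<close>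
        have "(\<Sum>j\<in>I - {i}. expectation (\<lambda>\<omega>. (Y j \<omega>)\<^sup>2 * min 1 \<bar>Y j \<omega>\<bar>)) \<le> (\<Sum>j\<in>I - {i}. \<beta> / n)"
          unfolding n_def by (intro sum_mono trunc) auto
        then show "(\<Sum>j\<in>I - {i}. expectation (\<lambda>\<omega>. (Y j \<omega>)\<^sup>2 * min 1 \<bar>Y j \<omega>\<bar>)) \<le> \<beta> * s2"
          unfolding sum_constant card_J by (simp add: s2_def mult.commute)
      qed (use fin in auto)
      also have "\<dots> = (y - x + 2 * \<beta>) * (1 / sqrt s2)" by simp
      also have "\<dots> \<le> (y - x + 2 * \<beta>) * c" using s2 xy \<beta> by (intro mult_left_mono) auto
      finally show "measure ?\<nu> {x..y} \<le> c * (y - x) + \<kappa>" by (simp add: \<kappa>_def algebra_simps)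
    qed
    have var\<mu>: "(\<integral>y. y\<^sup>2 \<partial>?\<mu>) = 1 / n" using var[OF i] i by (subst integral_distr) (auto simp: n_def)
    have iv: "indep_var borel (Y i) borel (V i)"
      unfolding V_def using fin i ind by (intro indep_vars_sum) (auto simp: insert_absorb)
    have "\<bar>(\<integral>y. y * (\<integral>v. f (v + y) - f v \<partial>?\<nu>) \<partial>?\<mu>) - (\<integral>y. y\<^sup>2 \<partial>?\<mu>) * (\<integral>y. \<nu>.smoothed a b y \<partial>?\<mu>)\<bar>
        \<le> ((\<nu>.slope + 2) * \<beta> + \<kappa>) * (\<integral>y. y\<^sup>2 \<partial>?\<mu>)"
      unfolding f_def
    proof (rule \<nu>.stein_term_bound[OF _ ab])
      show "real_distribution ?\<mu>" using i by simp
      show "2 \<le> \<nu>.slope" "\<nu>.slope \<le> 4" unfolding \<nu>.slope_def using sqrt2pi by (auto simp: c_def)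
      show "integrable ?\<mu> (\<lambda>y. y\<^sup>2)" using sq[OF i] i by (subst integrable_distr_eq) auto
      show "(\<integral>y. y\<^sup>2 * min 1 \<bar>y\<bar> \<partial>?\<mu>) \<le> \<beta> * (\<integral>y. y\<^sup>2 \<partial>?\<mu>)"
        unfolding var\<mu> using trunc[OF i] i by (subst integral_distr) (auto simp: n_def)
      \<comment> \<open>The association inequality with E Y_i^2 = 1/n; the common factor 1/n
        cancels.\<close>
      have "expectation (\<lambda>\<omega>. min 1 \<bar>Y i \<omega>\<bar>) / n \<le> \<beta> / n"
        using expectation_square_times_truncation_le[of "Y i"] sq[OF i] i var[OF i] trunc[OF i]
        by (simp add: n_def)
      then have "expectation (\<lambda>\<omega>. min 1 \<bar>Y i \<omega>\<bar>) \<le> \<beta>" using n by (simp add: divide_le_cancel)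
      then show "(\<integral>y. min 1 \<bar>y\<bar> \<partial>?\<mu>) \<le> \<beta>" using i by (subst integral_distr) auto
    qed
    moreover have "(\<integral>y. \<nu>.smoothed a b y \<partial>?\<mu>) = expectation (\<lambda>\<omega>. F (W \<omega>))"
      unfolding \<nu>.smoothed_def F_def[symmetric] W_eq[OF i]
      by (rule indep_var_expectation_iterated[OF iv, symmetric]) (use int_F i in auto)
    moreover have "(\<integral>y. y * (\<integral>v. f (v + y) - f v \<partial>?\<nu>) \<partial>?\<mu>) = expectation (\<lambda>\<omega>. Y i \<omega> * f (W \<omega>))"
    proof -
      have int_diff: "integrable M (\<lambda>\<omega>. Y i \<omega> * (f (V i \<omega> + Y i \<omega>) - f (V i \<omega>)))"
        using int_Yf[OF i, of "\<lambda>\<omega>. V i \<omega> + Y i \<omega>"] int_Yf[OF i, of "V i"] i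
        by (simp add: right_diff_distrib)
      have "(\<integral>y. y * (\<integral>v. f (v + y) - f v \<partial>?\<nu>) \<partial>?\<mu>) = (\<integral>y. (\<integral>v. y * (f (v + y) - f v) \<partial>?\<nu>) \<partial>?\<mu>)"
        by simp
      also have "\<dots> = expectation (\<lambda>\<omega>. Y i \<omega> * (f (V i \<omega> + Y i \<omega>) - f (V i \<omega>)))"
        by (rule indep_var_expectation_iterated[OF iv, symmetric]) (use int_diff in auto)
      also have "\<dots> = expectation (\<lambda>\<omega>. Y i \<omega> * f (W \<omega>)) - expectation (\<lambda>\<omega>. Y i \<omega> * f (V i \<omega>))"
        unfolding W_eq[OF i] using int_Yf[OF i, of "\<lambda>\<omega>. V i \<omega> + Y i \<omega>"] int_Yf[OF i, of "V i"] i
        by (simp add: right_diff_distrib)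
      \<comment> \<open>Y_i is centred and independent of V_i, so f(V_i) may be subtracted for
        free.\<close>
      also have "expectation (\<lambda>\<omega>. Y i \<omega> * f (V i \<omega>)) = 0"
      proof -
        have "indep_var borel (Y i) borel (\<lambda>\<omega>. f (V i \<omega>))"
          using indep_var_compose[OF iv, of "\<lambda>x. x" borel f borel] by (simp add: comp_def)
        moreover have "integrable M (\<lambda>\<omega>. f (V i \<omega>))"
          unfolding f_def by (rule integrable_const_bound[of _ "sqrt (2 * pi) / 2"])
            (use abs_stein_interval_le in \<open>simp_all only: real_norm_def AE_I2, measurable\<close>)
        ultimately have "expectation (\<lambda>\<omega>. Y i \<omega> * f (V i \<omega>)) = expectation (Y i) * expectation (\<lambda>\<omega>. f (V i \<omega>))"
          by (intro indep_var_lebesgue_integral int i)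
        then show ?thesis using zero[OF i] by simp
      qed
      finally show ?thesis by simp
    qed
    ultimately have "\<bar>expectation (\<lambda>\<omega>. Y i \<omega> * f (W \<omega>)) - expectation (\<lambda>\<omega>. F (W \<omega>)) / n\<bar>
        \<le> ((\<nu>.slope + 2) * \<beta> + \<kappa>) / n"
      by (simp add: var\<mu>)
    moreover have "\<nu>.slope + 2 = 3 + sqrt (2 * pi) / 2 + c" by (simp add: \<nu>.slope_def)
    ultimately have "\<bar>expectation (\<lambda>\<omega>. Y i \<omega> * f (W \<omega>)) - expectation (\<lambda>\<omega>. F (W \<omega>)) / n\<bar> \<le> C / n"
      by (simp add: C_def)
    then show ?thesis by (simp add: abs_minus_commute)
  qed
  define A where "A = {\<omega> \<in> space M. a < W \<omega> \<and> W \<omega> \<le> b}"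
  have [measurable]: "A \<in> events" unfolding A_def by measurable
  have "prob A = expectation (indicator A)" by simp
  \<comment> \<open>Stein's equation solved for the indicator of (a,b] and evaluated at W.\<close>
  also have "\<dots> = expectation (\<lambda>\<omega>. F (W \<omega>) - W \<omega> * f (W \<omega>) + (\<Phi> b - \<Phi> a))"
    by (rule Bochner_Integration.integral_cong)
       (auto simp: F_def f_def stein_interval_deriv_eq[OF ab] A_def indicator_def)
  also have "\<dots> = expectation (\<lambda>\<omega>. F (W \<omega>)) - expectation (\<lambda>\<omega>. W \<omega> * f (W \<omega>)) + (\<Phi> b - \<Phi> a)"
  proof -
    have "integrable M (\<lambda>\<omega>. W \<omega> * f (W \<omega>))"
      unfolding W_def sum_distrib_right by (rule Bochner_Integration.integrable_sum, rule int_Yf) auto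
    then show ?thesis using int_F[of W] by (simp add: prob_space)
  qed
  also have "expectation (\<lambda>\<omega>. W \<omega> * f (W \<omega>)) = (\<Sum>i\<in>I. expectation (\<lambda>\<omega>. Y i \<omega> * f (W \<omega>)))"
    unfolding W_def sum_distrib_right
    by (rule Bochner_Integration.integral_sum, rule int_Yf) auto
  also have "expectation (\<lambda>\<omega>. F (W \<omega>)) = (\<Sum>i\<in>I. expectation (\<lambda>\<omega>. F (W \<omega>)) / n)"
    using n by (simp add: n_def)
  finally have "prob A - (\<Phi> b - \<Phi> a) =
      (\<Sum>i\<in>I. expectation (\<lambda>\<omega>. F (W \<omega>)) / n - expectation (\<lambda>\<omega>. Y i \<omega> * f (W \<omega>)))"
    by (simp add: sum_subtractf)
  also have "\<bar>\<dots>\<bar> \<le> (\<Sum>i\<in>I. C / n)"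
    by (rule order.trans[OF sum_abs]) (rule sum_mono[OF summand])
  also have "\<dots> = C" using n by (simp add: n_def)
  also have "\<dots> \<le> 7.4184 * \<beta>"
  proof -
    have "C = (3 + sqrt (2 * pi) / 2 + 3 * c) * \<beta>" by (simp add: C_def \<kappa>_def algebra_simps)
    \<comment> \<open>With the coarse value 1.35 for sqrt(2 pi)/2 the factor is at most 3 + 1.35 +
      3.0375 = 7.3875.\<close>
    also have "\<dots> \<le> 7.4184 * \<beta>" using sqrt2pi \<beta> by (intro mult_right_mono) (auto simp: c_def)
    finally show ?thesis .
  qed
  finally show ?thesis by (simp add: A_def W_def)
qed

end

section \<open>Binomial random sums\<close>

definition thinned :: "real \<Rightarrow> real measure \<Rightarrow> real measure" where
  "thinned p \<rho> = distr (measure_pmf (bernoulli_pmf p) \<Otimes>\<^sub>M \<rho>) borel (\<lambda>(b, x). if b then x else 0)"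

text \<open>The thinned law is the mixture of \<rho> with weight p and the point mass at 0 with
  weight 1 - p.\<close>

lemma thinned:
  fixes g :: "real \<Rightarrow> 'b :: {banach, second_countable_topology}"
  assumes "real_distribution \<rho>" and p: "0 \<le> p" "p \<le> 1"
    and [measurable]: "g \<in> borel_measurable borel" and int: "integrable \<rho> g"
  shows integrable_thinned: "integrable (thinned p \<rho>) g"
    and integral_thinned: "integral\<^sup>L (thinned p \<rho>) g = p *\<^sub>R integral\<^sup>L \<rho> g + (1 - p) *\<^sub>R g 0"
proof -
  let ?B = "measure_pmf (bernoulli_pmf p)"
  interpret \<rho>: real_distribution \<rho> by fact
  interpret P: pair_prob_space ?B \<rho> ..
  have [measurable]: "(\<lambda>(b, x). if b then x else 0 :: real) \<in> borel_measurable (?B \<Otimes>\<^sub>M \<rho>)"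
    by measurable
  have int_b: "integrable \<rho> (\<lambda>x. g (if b then x else 0))" for b
    by (cases b) (use int in auto)
  have int_pair: "integrable (?B \<Otimes>\<^sub>M \<rho>) (\<lambda>(b, x). g (if b then x else 0))"
    by (rule P.Fubini_integrable) (use int_b in \<open>auto intro!: integrable_measure_pmf_finite\<close>)
  show "integrable (thinned p \<rho>) g"
    unfolding thinned_def using int_pair
    by (subst integrable_distr_eq) (auto simp: case_prod_unfold)
  have "integral\<^sup>L (thinned p \<rho>) g = (\<integral>b. (\<integral>x. g (if b then x else 0) \<partial>\<rho>) \<partial>?B)"
    unfolding thinned_def using P.integral_fst[OF int_pair]
    by (subst integral_distr) (auto simp: case_prod_unfold)
  also have "\<dots> = p *\<^sub>R integral\<^sup>L \<rho> g + (1 - p) *\<^sub>R g 0"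
    using p by (subst integral_measure_pmf[of UNIV]) (auto simp: UNIV_bool \<rho>.prob_space[simplified])
  finally show "integral\<^sup>L (thinned p \<rho>) g = p *\<^sub>R integral\<^sup>L \<rho> g + (1 - p) *\<^sub>R g 0" .
qed

lemma real_distribution_thinned:
  assumes "real_distribution \<rho>" shows "real_distribution (thinned p \<rho>)"
proof -
  interpret \<rho>: real_distribution \<rho> by fact
  interpret P: pair_prob_space "measure_pmf (bernoulli_pmf p)" \<rho> ..
  have [measurable]: "(\<lambda>(b, x). if b then x else 0 :: real)
      \<in> borel_measurable (measure_pmf (bernoulli_pmf p) \<Otimes>\<^sub>M \<rho>)"
    by measurable
  show ?thesis unfolding thinned_def by (rule P.real_distribution_distr) measurable
qed

lemma char_thinned:
  assumes "real_distribution \<rho>" "0 \<le> p" "p \<le> 1"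
  shows "char (thinned p \<rho>) t = of_real p * char \<rho> t + of_real (1 - p)"
proof -
  interpret \<rho>: real_distribution \<rho> by fact
  have "integrable \<rho> (\<lambda>x. iexp (t * x))" by (rule \<rho>.integrable_iexp) auto
  from integral_thinned[OF assms _ this] show ?thesis
    by (simp add: char_def scaleR_conv_of_real)
qed

section \<open>Independent copies as coordinates of a product space\<close>

lemma distr_PiM_coordinate:
  fixes \<mu> :: "real measure"
  assumes "real_distribution \<mu>" "i \<in> I"
  shows "distr (PiM I (\<lambda>_. \<mu>)) borel (\<lambda>\<omega>. \<omega> i) = \<mu>"
proof -
  interpret \<mu>: real_distribution \<mu> by fact
  have "distr (PiM I (\<lambda>_. \<mu>)) borel (\<lambda>\<omega>. \<omega> i) = distr (PiM I (\<lambda>_. \<mu>)) \<mu> (\<lambda>\<omega>. \<omega> i)"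
    by (rule distr_cong) auto
  also have "\<dots> = \<mu>" by (rule distr_PiM_component[OF _ assms(2)]) (rule \<mu>.prob_space_axioms)
  finally show ?thesis .
qed

lemma indep_vars_PiM_coordinates:
  fixes \<mu> :: "real measure"
  assumes "real_distribution \<mu>" "I \<noteq> {}"
  shows "prob_space.indep_vars (PiM I (\<lambda>_. \<mu>)) (\<lambda>_. borel) (\<lambda>i \<omega>. \<omega> i) I"
proof -
  interpret \<mu>: real_distribution \<mu> by fact
  interpret P: prob_space "PiM I (\<lambda>_. \<mu>)" by (rule prob_space_PiM) (rule \<mu>.prob_space_axioms)
  have [measurable]: "(\<lambda>\<omega>. \<omega> i) \<in> borel_measurable (PiM I (\<lambda>_. \<mu>))" if "i \<in> I" for i
    using measurable_component_singleton[OF that, of "\<lambda>_. \<mu>"]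
    by (simp cong: measurable_cong_sets)
    have "distr (PiM I (\<lambda>_. \<mu>)) (PiM I (\<lambda>_. borel)) (\<lambda>\<omega>. \<lambda>i\<in>I. \<omega> i)
        = distr (PiM I (\<lambda>_. \<mu>)) (PiM I (\<lambda>_. \<mu>)) (\<lambda>\<omega>. \<omega>)"
      by (rule distr_cong) (auto simp: space_PiM PiE_def extensional_restrict intro!: sets_PiM_cong)
    also have "\<dots> = PiM I (\<lambda>i. distr (PiM I (\<lambda>_. \<mu>)) borel (\<lambda>\<omega>. \<omega> i))"
      by (simp add: distr_PiM_coordinate[OF assms(1)] distr_id2 cong: PiM_cong)
    finally show ?thesis
      by (subst P.indep_vars_iff_distr_eq_PiM'[OF assms(2)]) auto
qed

section \<open>The characteristic function of a binomial random sum\<close>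

context prob_space begin

text \<open>Splitting by the value k of N and using independence gives the binomial generating
  function at \<open>char \<rho> t\<close>. The result is the n-th power of the characteristic
  function of the thinned law.\<close>

lemma char_random_sum:
  fixes X :: "nat \<Rightarrow> 'a \<Rightarrow> real" and N :: "'a \<Rightarrow> nat"
  assumes ind: "indep_vars (\<lambda>_. borel) (case_option (\<lambda>\<omega>. real (N \<omega>)) X) UNIV"
    and law: "\<And>i. distr M borel (X i) = \<rho>"
    and N: "distr M (count_space UNIV) N = measure_pmf (binomial_pmf n p)"
    and p: "0 \<le> p" "p \<le> 1"
  shows "random_variable borel (\<lambda>\<omega>. \<Sum>i<N \<omega>. X i \<omega>)"
    and "char (distr M borel (\<lambda>\<omega>. \<Sum>i<N \<omega>. X i \<omega>)) t = (of_real p * char \<rho> t + of_real (1 - p)) ^ n"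
proof -
  let ?Z = "case_option (\<lambda>\<omega>. real (N \<omega>)) X"
  have rvZ: "random_variable borel (?Z i)" for i
    using ind by (auto simp: indep_vars_def)
  have [measurable]: "random_variable borel (X i)" for i
    using rvZ[of "Some i"] by simp
  have [measurable]: "random_variable borel (\<lambda>\<omega>. real (N \<omega>))"
    using rvZ[of None] by simp
  \<comment> \<open>The independence hypothesis gives measurability of N only as a real variable;
    rounding down transfers it to the discrete space.\<close>
  have "N = (\<lambda>\<omega>. nat \<lfloor>real (N \<omega>)\<rfloor>)" by simp
  also have "\<dots> \<in> M \<rightarrow>\<^sub>M count_space UNIV" by measurable
  finally have N_meas [measurable]: "N \<in> M \<rightarrow>\<^sub>M count_space UNIV" .
  show S [measurable]: "random_variable borel (\<lambda>\<omega>. \<Sum>i<N \<omega>. X i \<omega>)"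
    by (rule measurable_compose_countable[OF _ N_meas, of "\<lambda>k \<omega>. \<Sum>i<k. X i \<omega>"]) measurable
  have prob_N: "prob {\<omega> \<in> space M. N \<omega> = k} = (n choose k) * p ^ k * (1 - p) ^ (n - k)" for k
  proof -
    have "prob {\<omega> \<in> space M. N \<omega> = k} = measure (distr M (count_space UNIV) N) {k}"
      by (subst measure_distr) (auto intro!: arg_cong[where f = prob])
    also have "\<dots> = pmf (binomial_pmf n p) k" unfolding N by (simp add: measure_pmf_single)
    finally show ?thesis using p by simp
  qed
  have N_le: "AE \<omega> in M. N \<omega> \<le> n"
  proof -
    have "AE k in distr M (count_space UNIV) N. k \<le> n"
      unfolding N using p by (auto simp: AE_measure_pmf_iff set_pmf_binomial_eq split: if_splits)
    then show ?thesis by (subst (asm) AE_distr_iff) auto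
  qed
  let ?I = "\<lambda>k \<omega>. complex_of_real (indicator {real k} (real (N \<omega>)))"
  let ?E = "\<lambda>k \<omega>. iexp (t * (\<Sum>i<k. X i \<omega>))"
  have int_E: "integrable M (?E k)" for k
    by (rule integrable_iexp) auto
  have int_I: "integrable M (?I k)" for k
    by (rule integrable_const_bound[of _ 1]) (auto simp: indicator_def)
  have indk: "indep_var borel (?I k) borel (?E k)" for k
  proof -
    \<comment> \<open>Index \<open>None\<close> carries N and the indices \<open>Some i\<close>
      carry X_i, so N is independent of every partial sum.\<close>
    have "indep_var borel (?Z None) borel (\<lambda>\<omega>. \<Sum>i\<in>Some ` {..<k}. ?Z i \<omega>)"
      by (rule indep_vars_sum) (auto intro: indep_vars_subset[OF ind])
    then have "indep_var borel (\<lambda>\<omega>. real (N \<omega>)) borel (\<lambda>\<omega>. \<Sum>i<k. X i \<omega>)"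
      by (simp add: sum.reindex)
    from indep_var_compose[OF this, of "\<lambda>x. complex_of_real (indicator {real k} x)" borel "\<lambda>x. iexp (t * x)" borel]
    show ?thesis by (simp add: comp_def)
  qed
  have char_k: "expectation (?E k) = char \<rho> t ^ k" for k
    using char_distr_sum[OF indep_vars_subset[OF ind, of "Some ` {..<k}"], of t] law
    by (simp add: char_def integral_distr sum.reindex prod.reindex)
  have "char (distr M borel (\<lambda>\<omega>. \<Sum>i<N \<omega>. X i \<omega>)) t = expectation (\<lambda>\<omega>. iexp (t * (\<Sum>i<N \<omega>. X i \<omega>)))"
    by (simp add: char_def integral_distr)
  also have "\<dots> = expectation (\<lambda>\<omega>. \<Sum>k\<le>n. ?I k \<omega> * ?E k \<omega>)"
  proof (rule integral_cong_AE)
    show "AE \<omega> in M. iexp (t * (\<Sum>i<N \<omega>. X i \<omega>)) = (\<Sum>k\<le>n. ?I k \<omega> * ?E k \<omega>)"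
      using N_le
    proof eventually_elim
      case (elim \<omega>)
      have "(\<Sum>k\<le>n. ?I k \<omega> * ?E k \<omega>) = (\<Sum>k\<le>n. if k = N \<omega> then ?E k \<omega> else 0)"
        by (rule sum.cong) (auto simp: indicator_def)
      with elim show ?case by (simp add: sum.delta)
    qed
  qed measurable
  also have "\<dots> = (\<Sum>k\<le>n. expectation (?I k) * expectation (?E k))"
    using indep_var_lebesgue_integral[OF indk int_I int_E] indep_var_integrable[OF indk int_I int_E]
    by (simp add: Bochner_Integration.integral_sum)
  also have "\<dots> = (\<Sum>k\<le>n. of_nat (n choose k) * (of_real p * char \<rho> t) ^ k * of_real (1 - p) ^ (n - k))"
  proof (rule sum.cong[OF refl])
    fix k
    have "expectation (?I k) = of_real (expectation (\<lambda>\<omega>. indicator {\<omega> \<in> space M. N \<omega> = k} \<omega>))"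
      unfolding integral_complex_of_real[symmetric]
      by (rule Bochner_Integration.integral_cong) (auto simp: indicator_def)
    also have "\<dots> = of_real ((n choose k) * p ^ k * (1 - p) ^ (n - k))" by (simp add: prob_N)
    finally show "expectation (?I k) * expectation (?E k)
      = of_nat (n choose k) * (of_real p * char \<rho> t) ^ k * of_real (1 - p) ^ (n - k)"
      unfolding char_k by (simp add: power_mult_distrib)
  qed
  also have "\<dots> = (of_real p * char \<rho> t + of_real (1 - p)) ^ n"
    by (rule binomial_ring[symmetric])
  finally show "char (distr M borel (\<lambda>\<omega>. \<Sum>i<N \<omega>. X i \<omega>)) t = (of_real p * char \<rho> t + of_real (1 - p)) ^ n" .
qed

end

text \<open>Among windows of length 2u the one centred at 0 has the largest normal mass: sliding
  towards the centre replaces the density at one end by a larger one at the other. Thus \<Phi>_0(u)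
  is the normal concentration function at 2u.\<close>

lemma normal_cdf_interval_le:
  assumes "0 \<le> u" shows "\<Phi> (x + 2 * u) - \<Phi> x \<le> 2 * \<Phi> u - 1"
proof -
  define D where "D x = \<Phi> (x + 2 * u) - \<Phi> x" for x
  have d: "(D has_real_derivative (std_normal_density (x + 2 * u) - std_normal_density x)) (at x)" for x
  proof -
    have "((\<lambda>x. \<Phi> (x + 2 * u)) has_real_derivative std_normal_density (x + 2 * u) * 1) (at x)"
      by (rule DERIV_chain2[OF normal_cdf_deriv]) (auto intro!: derivative_eq_intros)
    then show ?thesis unfolding D_def[abs_def] by (auto intro!: DERIV_diff normal_cdf_deriv)
  qed
  have dens: "std_normal_density x \<le> std_normal_density y" if "\<bar>y\<bar> \<le> \<bar>x\<bar>" for x y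
    using that by (auto simp: std_normal_density_def abs_le_square_iff intro!: divide_right_mono)
  have "D x \<le> D (- u)"
  proof (cases "x \<le> - u")
    case True
    then show ?thesis
      by (rule DERIV_nonneg_imp_nondecreasing) (use assms in \<open>auto intro!: exI d dens\<close>)
  next
    case False
    then have "- u \<le> x" by simp
    then show ?thesis
      by (rule DERIV_nonpos_imp_nonincreasing) (use assms in \<open>auto intro!: exI d dens\<close>)
  qed
  also have "D (- u) = 2 * \<Phi> u - 1" by (simp add: D_def normal_cdf_uminus)
  finally show ?thesis by (simp add: D_def)
qed

text \<open>The left side is the tangent at s = k^2 of the convex function s^(3/2), with s = y^2.
  For |y| > 1 the slope 3k/2 is at most 1 by the choice of range for k. Its expectation needs only
  the second moment, which gives lower bounds on \<beta>.\<close>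

lemma tangent_le_truncated_square:
  fixes y k :: real
  assumes "0 \<le> k" "k \<le> 2/3"
  shows "3/2 * k * y\<^sup>2 - k ^ 3 / 2 \<le> y\<^sup>2 * min 1 \<bar>y\<bar>"
proof (cases "\<bar>y\<bar> \<le> 1")
  case True
  have "0 \<le> (\<bar>y\<bar> - k)\<^sup>2 * (2 * \<bar>y\<bar> + k)" using assms by simp
  also have "\<dots> = 2 * (\<bar>y\<bar>\<^sup>2 * \<bar>y\<bar>) - 3 * k * \<bar>y\<bar>\<^sup>2 + k ^ 3" by (simp add: power2_eq_square power3_eq_cube algebra_simps)
  finally show ?thesis using True by simp
next
  case False
  have "3/2 * k * y\<^sup>2 \<le> 1 * y\<^sup>2" using assms by (intro mult_right_mono) auto
  moreover have "0 \<le> k ^ 3" using assms by simp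
  ultimately have "3/2 * k * y\<^sup>2 - k ^ 3 / 2 \<le> y\<^sup>2" by linarith
  with False show ?thesis by simp
qed

lemma prob_thinned_sum_interval:
  fixes \<rho> :: "real measure" and \<sigma> p :: real and n :: nat
  assumes \<rho>: "real_distribution \<rho>" and p: "0 < p" "p \<le> 1" and n: "1 \<le> n"
    and mean: "integrable \<rho> (\<lambda>x. x)" "(\<integral>x. x \<partial>\<rho>) = 0"
    and var: "integrable \<rho> (\<lambda>x. x\<^sup>2)" "(\<integral>x. x\<^sup>2 \<partial>\<rho>) = \<sigma>\<^sup>2" "0 < \<sigma>"
  defines "\<tau> \<equiv> \<sigma> * sqrt (real n * p)"
  defines "\<beta> \<equiv> (\<integral>x. x\<^sup>2 * min 1 (\<bar>x\<bar> / \<tau>) \<partial>\<rho>) / \<sigma>\<^sup>2"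
  assumes \<beta>: "7.4184 * \<beta> < 1" and ab: "a \<le> b"
  defines "P \<equiv> PiM {..<n} (\<lambda>_. thinned p \<rho>)"
  shows "\<bar>measure P {\<omega> \<in> space P. a < (\<Sum>i<n. \<omega> i) / \<tau> \<and> (\<Sum>i<n. \<omega> i) / \<tau> \<le> b} - (\<Phi> b - \<Phi> a)\<bar> \<le> 7.4184 * \<beta>"
proof -
  interpret \<rho>: real_distribution \<rho> by fact
  let ?\<mu> = "thinned p \<rho>"
  have \<mu>: "real_distribution ?\<mu>" using \<rho> by (rule real_distribution_thinned)
  interpret \<mu>: real_distribution ?\<mu> by fact
  interpret P: prob_space P unfolding P_def by (rule prob_space_PiM) (rule \<mu>.prob_space_axioms)
  have \<tau>: "0 < \<tau>" "\<tau>\<^sup>2 = \<sigma>\<^sup>2 * (n * p)" using p n var by (auto simp: \<tau>_def power_mult_distrib)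
  have np: "0 < n * p" using p n by simp
  have int_trunc: "integrable \<rho> (\<lambda>x. x\<^sup>2 * min 1 (\<bar>x\<bar> / \<tau>))"
    by (rule Bochner_Integration.integrable_bound[OF var(1)])
       (use \<tau> in \<open>auto simp: abs_mult intro!: mult_left_le\<close>)
  define Y where "Y i \<omega> = \<omega> i / \<tau>" for i :: nat and \<omega> :: "nat \<Rightarrow> real"
  have coord [measurable]: "(\<lambda>\<omega>. \<omega> i) \<in> borel_measurable P" if "i < n" for i
    using measurable_component_singleton[of i "{..<n}" "\<lambda>_. ?\<mu>"] that
    by (simp add: P_def cong: measurable_cong_sets)
  have transfer: "integrable P (\<lambda>\<omega>. g (\<omega> i))" "P.expectation (\<lambda>\<omega>. g (\<omega> i)) = p * integral\<^sup>L \<rho> g + (1 - p) * g 0"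
    if i: "i < n" and [measurable]: "g \<in> borel_measurable borel" and int: "integrable \<rho> g" for i and g :: "real \<Rightarrow> real"
  proof -
    have law: "distr P borel (\<lambda>\<omega>. \<omega> i) = ?\<mu>"
      unfolding P_def using i by (intro distr_PiM_coordinate \<mu>) simp
    have "integrable (distr P borel (\<lambda>\<omega>. \<omega> i)) g"
      unfolding law using int p by (intro integrable_thinned \<rho>) auto
    then show "integrable P (\<lambda>\<omega>. g (\<omega> i))" using i by (subst (asm) integrable_distr_eq) auto
    have "P.expectation (\<lambda>\<omega>. g (\<omega> i)) = integral\<^sup>L (distr P borel (\<lambda>\<omega>. \<omega> i)) g"
      using i by (subst integral_distr) auto
    then show "P.expectation (\<lambda>\<omega>. g (\<omega> i)) = p * integral\<^sup>L \<rho> g + (1 - p) * g 0"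
      unfolding law using int p by (simp add: integral_thinned \<rho>)
  qed
  have ind: "P.indep_vars (\<lambda>_. borel) Y {..<n}"
  proof -
    have "P.indep_vars (\<lambda>_. borel) (\<lambda>i \<omega>. \<omega> i) {..<n}"
      unfolding P_def using n by (intro indep_vars_PiM_coordinates \<mu>) (auto simp: lessThan_empty_iff)
    from P.indep_vars_compose2[OF this, of "\<lambda>_ x. x / \<tau>" "\<lambda>_. borel"] show ?thesis
      unfolding Y_def by simp
  qed
  have Y_zero: "P.expectation (Y i) = 0" if "i < n" for i
  proof -
    have "P.expectation (\<lambda>\<omega>. \<omega> i / \<tau>) = p * (\<integral>x. x / \<tau> \<partial>\<rho>) + (1 - p) * (0 / \<tau>)"
    proof (rule transfer(2)[OF that])
      show "(\<lambda>x. x / \<tau>) \<in> borel_measurable borel" by measurable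
      show "integrable \<rho> (\<lambda>x. x / \<tau>)" by (rule Bochner_Integration.integrable_divide) (rule mean(1))
    qed
    also have "\<dots> = 0" using mean(2) by simp
    finally show ?thesis unfolding Y_def .
  qed
  have Y_sq: "integrable P (\<lambda>\<omega>. (Y i \<omega>)\<^sup>2)" if "i < n" for i
    using transfer(1)[OF that, of "\<lambda>x. (x / \<tau>)\<^sup>2"] var by (simp add: Y_def power_divide)
  have Y_var: "P.expectation (\<lambda>\<omega>. (Y i \<omega>)\<^sup>2) = 1 / n" if "i < n" for i
    using transfer(2)[OF that, of "\<lambda>x. (x / \<tau>)\<^sup>2"] var p by (simp add: Y_def power_divide \<tau>(2))
  have Y_trunc: "integrable P (\<lambda>\<omega>. (Y i \<omega>)\<^sup>2 * min 1 \<bar>Y i \<omega>\<bar>)"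
    "P.expectation (\<lambda>\<omega>. (Y i \<omega>)\<^sup>2 * min 1 \<bar>Y i \<omega>\<bar>) = \<beta> / n" if "i < n" for i
  proof -
    have eq: "(x / \<tau>)\<^sup>2 * min 1 \<bar>x / \<tau>\<bar> = x\<^sup>2 * min 1 (\<bar>x\<bar> / \<tau>) / \<tau>\<^sup>2" for x
      using \<tau> by (simp add: power_divide)
    show "integrable P (\<lambda>\<omega>. (Y i \<omega>)\<^sup>2 * min 1 \<bar>Y i \<omega>\<bar>)"
      unfolding Y_def eq
      using transfer(1)[OF that, of "\<lambda>x. x\<^sup>2 * min 1 (\<bar>x\<bar> / \<tau>) / \<tau>\<^sup>2"] int_trunc by simp
    have "P.expectation (\<lambda>\<omega>. (Y i \<omega>)\<^sup>2 * min 1 \<bar>Y i \<omega>\<bar>) = p * ((\<integral>x. x\<^sup>2 * min 1 (\<bar>x\<bar> / \<tau>) \<partial>\<rho>) / \<tau>\<^sup>2)"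
      unfolding Y_def eq
      using transfer(2)[OF that, of "\<lambda>x. x\<^sup>2 * min 1 (\<bar>x\<bar> / \<tau>) / \<tau>\<^sup>2"] int_trunc by simp
    also have "\<dots> = \<beta> / n" using p n var by (simp add: \<beta>_def \<tau>(2))
    finally show "P.expectation (\<lambda>\<omega>. (Y i \<omega>)\<^sup>2 * min 1 \<bar>Y i \<omega>\<bar>) = \<beta> / n" .
  qed
  \<comment> \<open>The tangent bound is averaged for one summand of variance 1/n and multiplied by
    n.\<close>
  have lower: "3/2 * k - n * k ^ 3 / 2 \<le> \<beta>" if k: "0 \<le> k" "k \<le> 2/3" for k :: real
  proof -
    have "0 < n" using n by simp
    have "P.expectation (\<lambda>\<omega>. 3/2 * k * (Y 0 \<omega>)\<^sup>2 - k ^ 3 / 2)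
        \<le> P.expectation (\<lambda>\<omega>. (Y 0 \<omega>)\<^sup>2 * min 1 \<bar>Y 0 \<omega>\<bar>)"
      by (rule integral_mono)
         (use Y_sq[OF \<open>0 < n\<close>] Y_trunc(1)[OF \<open>0 < n\<close>] tangent_le_truncated_square[OF k] in auto)
    then have "3/2 * k / n - k ^ 3 / 2 \<le> \<beta> / n"
      using Y_sq Y_var Y_trunc(2) \<open>0 < n\<close> by (simp add: P.prob_space)
    then have "n * (3/2 * k / n - k ^ 3 / 2) \<le> n * (\<beta> / n)" by (rule mult_left_mono) simp
    then show ?thesis using \<open>0 < n\<close> by (simp add: right_diff_distrib)
  qed
  have card: "41 \<le> n"
  proof -
    \<comment> \<open>The fixed k = 1/5 is admissible before n is known to be large. Since \<beta> <
      1/7.4184 < 0.135, it forces n > 41.25, of which n > 40 is used.\<close>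
    have "0.3 - n * 0.004 \<le> \<beta>" using lower[of "1/5"] by (simp add: power3_eq_cube)
    then have "40 < real n" using \<beta> by simp
    then show ?thesis by simp
  qed
  have \<beta>_pos: "0 < \<beta>"
  proof -
    have s: "6 \<le> sqrt n" using card by (intro real_le_rsqrt) simp
    have "1 / sqrt n \<le> 1 / 6" using s card by (intro divide_left_mono) auto
    \<comment> \<open>k = 1 / \<open>sqrt n\<close> maximizes the lower bound and is admissible now
      that n is large.\<close>
    then have "3/2 * (1 / sqrt n) - n * (1 / sqrt n) ^ 3 / 2 \<le> \<beta>" by (intro lower) auto
    also have "n * (1 / sqrt n) ^ 3 = 1 / sqrt n"
      using card by (simp add: power3_eq_cube)
    finally have "1 / sqrt n \<le> \<beta>" by simp
    moreover have "0 < 1 / sqrt n" using card by simp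
    ultimately show ?thesis by linarith
  qed
  have "\<bar>P.prob {\<omega> \<in> space P. a < (\<Sum>i<n. Y i \<omega>) \<and> (\<Sum>i<n. Y i \<omega>) \<le> b} - (\<Phi> b - \<Phi> a)\<bar> \<le> 7.4184 * \<beta>"
    by (rule P.normalized_sum_interval_bound)
       (use card ind Y_zero Y_sq Y_var Y_trunc \<beta>_pos \<beta> ab in auto)
  then show ?thesis by (simp add: Y_def sum_divide_distrib)
qed

theorem corollary2:
  fixes M :: "'a measure"
    and X :: "nat \<Rightarrow> 'a \<Rightarrow> real"
    and N :: "'a \<Rightarrow> nat"
    and \<sigma> p :: real
    and n :: nat
  assumes "prob_space M"
    and "n \<ge> 1" and "0 < p" and "p \<le> 1"
    and "prob_space.indep_vars M (\<lambda>_. borel) (case_option (\<lambda>\<omega>. real (N \<omega>)) X) UNIV"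
    and "\<And>i. distr M borel (X i) = distr M borel (X 0)"
    and "distr M (count_space UNIV) N = measure_pmf (binomial_pmf n p)"
    and "integrable M (X 0)" and "(\<integral>\<omega>. X 0 \<omega> \<partial>M) = 0"
    and "integrable M (\<lambda>\<omega>. (X 0 \<omega>)\<^sup>2)" and "(\<integral>\<omega>. (X 0 \<omega>)\<^sup>2 \<partial>M) = \<sigma>\<^sup>2" and "\<sigma> > 0"
  shows "(SUP z\<in>{0..}.
            \<bar>concentration_function M (\<lambda>\<omega>. \<Sum>i<N \<omega>. X i \<omega>) z
              - folded_normal_cdf (z / (2 * \<sigma> * sqrt (real n * p)))\<bar>)
         \<le> 7.4184 / \<sigma>\<^sup>2 * (\<integral>\<omega>. (X 0 \<omega>)\<^sup>2 * min 1 (\<bar>X 0 \<omega>\<bar> / (\<sigma> * sqrt (real n * p))) \<partial>M)"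
proof -
  interpret M: prob_space M by fact
  define S where "S \<omega> = (\<Sum>i<N \<omega>. X i \<omega>)" for \<omega>
  define \<rho> where "\<rho> = distr M borel (X 0)"
  define \<tau> where "\<tau> = \<sigma> * sqrt (real n * p)"
  define \<beta> where "\<beta> = (\<integral>x. x\<^sup>2 * min 1 (\<bar>x\<bar> / \<tau>) \<partial>\<rho>) / \<sigma>\<^sup>2"
  have X0 [measurable]: "M.random_variable borel (X 0)" using assms(8) by simp
  have \<rho>: "real_distribution \<rho>" by (simp add: \<rho>_def)
  have \<tau>: "0 < \<tau>" using assms by (simp add: \<tau>_def)
  have rhs: "7.4184 / \<sigma>\<^sup>2 * (\<integral>\<omega>. (X 0 \<omega>)\<^sup>2 * min 1 (\<bar>X 0 \<omega>\<bar> / (\<sigma> * sqrt (real n * p))) \<partial>M) = 7.4184 * \<beta>"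
    unfolding \<beta>_def \<rho>_def \<tau>_def[symmetric] by (subst integral_distr) auto
  have S_meas [measurable]: "M.random_variable borel S"
    and S_char: "char (distr M borel S) t = (of_real p * char \<rho> t + of_real (1 - p)) ^ n" for t
    unfolding S_def[abs_def]
    using M.char_random_sum[OF assms(5) _ assms(7), of \<rho>] assms(3,4) assms(6) by (auto simp: \<rho>_def)
  have Q_bounds: "0 \<le> concentration_function M S z" "concentration_function M S z \<le> 1" for z
    using concentration_function_bounds[OF assms(1)] by auto
  have folded_bounds: "0 \<le> folded_normal_cdf x" "folded_normal_cdf x \<le> 1" for x
  proof -
    have "\<Phi> 0 \<le> \<Phi> x" if "0 \<le> x" using that by (rule std_normal.cdf_nondecreasing)
    then show "0 \<le> folded_normal_cdf x" using normal_cdf_uminus[of 0] by (auto simp: folded_normal_cdf_def)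
    show "folded_normal_cdf x \<le> 1" using abs_folded_normal_cdf_le[of x] by simp
  qed
  have "\<bar>concentration_function M S z - folded_normal_cdf (z / (2 * \<tau>))\<bar> \<le> 7.4184 * \<beta>" if z: "0 \<le> z" for z
  proof (cases "7.4184 * \<beta> < 1")
    case False
    \<comment> \<open>Both functions take values in [0, 1], so a bound of at least 1 holds
      trivially.\<close>
    then show ?thesis using Q_bounds[of z] folded_bounds[of "z / (2 * \<tau>)"] by linarith
  next
    case \<beta>: True
    define P where "P = PiM {..<n} (\<lambda>_. thinned p \<rho>)"
    have \<mu>: "real_distribution (thinned p \<rho>)" using \<rho> by (rule real_distribution_thinned)
    interpret \<mu>: real_distribution "thinned p \<rho>" by fact
    interpret P: prob_space P unfolding P_def by (rule prob_space_PiM) (rule \<mu>.prob_space_axioms)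
    have indP: "P.indep_vars (\<lambda>_. borel) (\<lambda>i \<omega>. \<omega> i) {..<n}"
      unfolding P_def using assms(2) by (intro indep_vars_PiM_coordinates \<mu>) (auto simp: lessThan_empty_iff)
    have coord [measurable]: "(\<lambda>\<omega>. \<omega> i) \<in> borel_measurable P" if "i < n" for i
      using indP that by (auto simp: P.indep_vars_def)
    have T_meas [measurable]: "(\<lambda>\<omega>. \<Sum>i<n. \<omega> i) \<in> borel_measurable P" by measurable
    \<comment> \<open>Both characteristic functions are the n-th power of p *
      \<open>char \<rho> t\<close> + (1 - p): on the product space by independence of the
      coordinates, for S by the binomial theorem.\<close>
    have law: "distr P borel (\<lambda>\<omega>. \<Sum>i<n. \<omega> i) = distr M borel S"
    proof (rule Levy_uniqueness)
      show "char (distr P borel (\<lambda>\<omega>. \<Sum>i<n. \<omega> i)) = char (distr M borel S)"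
      proof
        fix t
        have "char (distr P borel (\<lambda>\<omega>. \<omega> i)) t = char (thinned p \<rho>) t" if "i < n" for i
          unfolding P_def using distr_PiM_coordinate[OF \<mu>, of i "{..<n}"] that by simp
        then show "char (distr P borel (\<lambda>\<omega>. \<Sum>i<n. \<omega> i)) t = char (distr M borel S) t"
          using P.char_distr_sum[OF indP, of t] char_thinned[OF \<rho>, of p t] assms(3,4)
          by (simp add: S_char)
      qed
    qed simp_all
    have half_open: "\<bar>M.prob {\<omega> \<in> space M. a < S \<omega> / \<tau> \<and> S \<omega> / \<tau> \<le> b} - (\<Phi> b - \<Phi> a)\<bar> \<le> 7.4184 * \<beta>"
      if ab: "a \<le> b" for a b
    proof -
      have B: "{x. a < x / \<tau> \<and> x / \<tau> \<le> b} \<in> sets borel" by measurable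
      have "M.prob {\<omega> \<in> space M. a < S \<omega> / \<tau> \<and> S \<omega> / \<tau> \<le> b} = measure (distr M borel S) {x. a < x / \<tau> \<and> x / \<tau> \<le> b}"
        using B by (subst measure_distr) (auto intro!: arg_cong[where f = M.prob])
      also have "\<dots> = P.prob {\<omega> \<in> space P. a < (\<Sum>i<n. \<omega> i) / \<tau> \<and> (\<Sum>i<n. \<omega> i) / \<tau> \<le> b}"
        unfolding law[symmetric] using B by (subst measure_distr) (auto intro!: arg_cong[where f = P.prob])
      finally show ?thesis
        using prob_thinned_sum_interval[OF \<rho> assms(3,4,2) _ _ _ _ assms(12) _ ab] \<beta> assms(8-11)
        unfolding P_def \<beta>_def \<tau>_def \<rho>_def
        by (auto simp: integrable_distr_eq integral_distr)
    qed
    have closed_lower: "\<Phi> b - \<Phi> a - 7.4184 * \<beta> \<le> M.prob {\<omega> \<in> space M. a \<le> S \<omega> / \<tau> \<and> S \<omega> / \<tau> \<le> b}"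
      if ab: "a \<le> b" for a b
    proof -
      have "M.prob {\<omega> \<in> space M. a < S \<omega> / \<tau> \<and> S \<omega> / \<tau> \<le> b} \<le> M.prob {\<omega> \<in> space M. a \<le> S \<omega> / \<tau> \<and> S \<omega> / \<tau> \<le> b}"
        by (rule M.finite_measure_mono) auto
      then show ?thesis using half_open[OF ab] by linarith
    qed
    \<comment> \<open>A possible atom at a is caught by opening the interval at a - e; the added
      normal mass is at most e, which is arbitrary.\<close>
    have closed_upper: "M.prob {\<omega> \<in> space M. a \<le> S \<omega> / \<tau> \<and> S \<omega> / \<tau> \<le> b} \<le> \<Phi> b - \<Phi> a + 7.4184 * \<beta>"
      if ab: "a \<le> b" for a b
    proof (rule field_le_epsilon)
      fix e :: real assume e: "0 < e"
      have "M.prob {\<omega> \<in> space M. a \<le> S \<omega> / \<tau> \<and> S \<omega> / \<tau> \<le> b} \<le> M.prob {\<omega> \<in> space M. a - e < S \<omega> / \<tau> \<and> S \<omega> / \<tau> \<le> b}"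
        by (rule M.finite_measure_mono) (use e in auto)
      then show "M.prob {\<omega> \<in> space M. a \<le> S \<omega> / \<tau> \<and> S \<omega> / \<tau> \<le> b} \<le> \<Phi> b - \<Phi> a + 7.4184 * \<beta> + e"
        using half_open[of "a - e" b] ab e normal_cdf_diff_le[of "a - e" a] by linarith
    qed
    \<comment> \<open>Half the window length in units of \<tau>, which is the argument of
      \<Phi>_0.\<close>
    define u where "u = z / (2 * \<tau>)"
    have u: "0 \<le> u" "folded_normal_cdf u = 2 * \<Phi> u - 1" "z / \<tau> = 2 * u"
      using z \<tau> by (auto simp: u_def folded_normal_cdf_def)
    have scale: "{\<omega> \<in> space M. x \<le> S \<omega> \<and> S \<omega> \<le> x + z}
        = {\<omega> \<in> space M. x / \<tau> \<le> S \<omega> / \<tau> \<and> S \<omega> / \<tau> \<le> x / \<tau> + 2 * u}" for x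
      using \<tau> by (auto simp flip: u(3) add_divide_distrib simp: divide_le_cancel)
    have "concentration_function M S z \<le> 2 * \<Phi> u - 1 + 7.4184 * \<beta>"
      unfolding concentration_function_def scale
    proof (rule cSUP_least)
      fix x :: real
      show "M.prob {\<omega> \<in> space M. x / \<tau> \<le> S \<omega> / \<tau> \<and> S \<omega> / \<tau> \<le> x / \<tau> + 2 * u} \<le> 2 * \<Phi> u - 1 + 7.4184 * \<beta>"
        using closed_upper[of "x / \<tau>" "x / \<tau> + 2 * u"] normal_cdf_interval_le[OF u(1), of "x / \<tau>"] u by simp
    qed simp
    moreover have "2 * \<Phi> u - 1 - 7.4184 * \<beta> \<le> concentration_function M S z"
    proof -
      \<comment> \<open>For the lower bound the single centred window, optimal for the normal law,
        suffices as a competitor in the supremum.\<close>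
      have "2 * \<Phi> u - 1 - 7.4184 * \<beta> \<le> M.prob {\<omega> \<in> space M. - u \<le> S \<omega> / \<tau> \<and> S \<omega> / \<tau> \<le> u}"
        using closed_lower[of "- u" u] u by (simp add: normal_cdf_uminus)
      also have "\<dots> = M.prob {\<omega> \<in> space M. - (u * \<tau>) \<le> S \<omega> \<and> S \<omega> \<le> - (u * \<tau>) + z}"
        unfolding scale using \<tau> by simp
      also have "\<dots> \<le> concentration_function M S z"
        unfolding concentration_function_def
        by (rule cSUP_upper[OF UNIV_I bdd_above_concentration[OF assms(1)]])
      finally show ?thesis .
    qed
    ultimately show ?thesis unfolding u_def[symmetric] u(2) by linarith
  qed
  then show ?thesis
    unfolding rhs S_def[symmetric] \<tau>_def by (intro cSUP_least) (auto simp: mult.assoc)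
qed

end
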